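(* The family $\mathcal{E}$ is exactly the family of $(3,2)$-critical graphs without isolated vertices that contain at least five odd cycles. That is, a graph $G$ without isolated vertices is $(3,2)$-critical and contains at least five odd cycles if and only if $G\in\mathcal{E}$ (up to isomorphism).
   Context: All graphs are finite and simple. $\chi(G)$ is the chromatic number of $G$. The chromatic edge-stability number $es_{\chi}(G)$ is the minimum number of edges of $G$ whose removal results in a (spanning sub)graph with chromatic number smaller than $\chi(G)$. $G-e$ denotes $G$ with the edge $e$ deleted. A graph $G$ is $(3,2)$-critical if $\chi(G)=3$, $es_{\chi}(G)=2$, and $es_{\chi}(G-e)<es_{\chi}(G)$ for every edge $e\in E(G)$. Cycles of $G$ are counted as subgraphs; a cycle is odd (even) if it has an odd (even) number of edges. $d_H(u,v)$ is the length of a shortest $(u,v)$-path in $H$. The family $\mathcal{E}$: let $k\ge 3$ and take the disjoint union of $k$ even cycles $C_{2n_1},\ldots,C_{2n_k}$ (each $n_i\ge 2$). For each $i\in\{1,\dots,k\}$ let $x_i$ and $y_i$ be any two distinct vertices of $C_{2n_i}$, subject only to the requirement that $\sum_{i=1}^k d_{C_{2n_i}}(x_i,y_i)$ is odd. A graph $G\in\mathcal{E}$ is obtained by identifying $y_i$ with $x_{i+1}$ for each $i\in\{1,\dots,k-1\}$, and identifying $y_k$ with $x_1$. *)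

theory Defs
  imports Main
begin

datatype 'a graph = Graph (verts: "'a set") (edges: "'a set set")

definition simple_graph :: "'a graph \<Rightarrow> bool" where
  "simple_graph G \<longleftrightarrow> finite (verts G) \<and> (\<forall>e\<in>edges G. e \<subseteq> verts G \<and> card e = 2)"

definition no_isolated :: "'a graph \<Rightarrow> bool" where
  "no_isolated G \<longleftrightarrow> (\<forall>v\<in>verts G. \<exists>e\<in>edges G. v \<in> e)"

definition delete_edges :: "'a graph \<Rightarrow> 'a set set \<Rightarrow> 'a graph" where
  "delete_edges G F = Graph (verts G) (edges G - F)"

definition subgraph :: "'a graph \<Rightarrow> 'a graph \<Rightarrow> bool" where
  "subgraph H G \<longleftrightarrow> verts H \<subseteq> verts G \<and> edges H \<subseteq> edges G"

definition isomorphic :: "'a graph \<Rightarrow> 'b graph \<Rightarrow> bool" where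
  "isomorphic G H \<longleftrightarrow>
     (\<exists>f. bij_betw f (verts G) (verts H) \<and> edges H = (\<lambda>e. f ` e) ` edges G)"

definition colorable :: "'a graph \<Rightarrow> nat \<Rightarrow> bool" where
  "colorable G k \<longleftrightarrow>
     (\<exists>c. c ` verts G \<subseteq> {..<k} \<and> (\<forall>u v. {u, v} \<in> edges G \<longrightarrow> c u \<noteq> c v))"

definition chromatic_number :: "'a graph \<Rightarrow> nat" where
  "chromatic_number G = (LEAST k. colorable G k)"

text \<open>The minimum below is over a nonempty set exactly when the (finite simple) graph has an
  edge; for edgeless graphs the value is unspecified.\<close>

definition edge_stability :: "'a graph \<Rightarrow> nat" where
  "edge_stability G =
     (LEAST m. \<exists>F\<subseteq>edges G. card F = m \<and>
        chromatic_number (delete_edges G F) < chromatic_number G)"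

definition critical_3_2 :: "'a graph \<Rightarrow> bool" where
  "critical_3_2 G \<longleftrightarrow> chromatic_number G = 3 \<and> edge_stability G = 2 \<and>
     (\<forall>e\<in>edges G. edge_stability (delete_edges G {e}) < edge_stability G)"

text \<open>This is a cycle only for \<open>m \<ge> 3\<close>.\<close>

definition cycle_graph :: "nat \<Rightarrow> nat graph" where
  "cycle_graph m = Graph {..<m} {{j, Suc j mod m} | j. j < m}"

definition odd_cycles :: "'a graph \<Rightarrow> 'a graph set" where
  "odd_cycles G =
     {H. subgraph H G \<and> (\<exists>m\<ge>3. isomorphic (cycle_graph m) H) \<and> odd (card (edges H))}"

definition is_path :: "'a graph \<Rightarrow> 'a \<Rightarrow> 'a list \<Rightarrow> 'a \<Rightarrow> bool" where
  "is_path G u p v \<longleftrightarrow> p \<noteq> [] \<and> hd p = u \<and> last p = v \<and> distinct p \<and> set p \<subseteq> verts G \<and>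
     successively (\<lambda>a b. {a, b} \<in> edges G) p"

definition graph_dist :: "'a graph \<Rightarrow> 'a \<Rightarrow> 'a \<Rightarrow> nat" where
  "graph_dist G u v = (LEAST l. \<exists>p. is_path G u p v \<and> length p = Suc l)"

definition disjoint_union :: "'i set \<Rightarrow> ('i \<Rightarrow> 'a graph) \<Rightarrow> ('i \<times> 'a) graph" where
  "disjoint_union I G =
     Graph (SIGMA i:I. verts (G i)) (\<Union>i\<in>I. (\<lambda>e. Pair i ` e) ` edges (G i))"

text \<open>Identifying \<open>u\<close> with \<open>v\<close> for every \<open>(u, v) \<in> S\<close>: the new vertices are the classes of the
  equivalence relation generated by \<open>S\<close>.\<close>

definition identify :: "('a \<times> 'a) set \<Rightarrow> 'a graph \<Rightarrow> 'a set graph" where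
  "identify S G = (let R = (S \<union> S\<inverse>)\<^sup>* in
     Graph (verts G // R) ((\<lambda>e. (\<lambda>v. R `` {v}) ` e) ` edges G))"

text \<open>The \<open>k\<close> cycles are numbered \<open>0, \<dots>, k - 1\<close>, so that \<open>y\<close> of cycle \<open>i\<close> is glued to \<open>x\<close> of
  cycle \<open>i + 1\<close> modulo \<open>k\<close>.\<close>

definition cycle_ring ::
  "nat \<Rightarrow> (nat \<Rightarrow> nat) \<Rightarrow> (nat \<Rightarrow> nat) \<Rightarrow> (nat \<Rightarrow> nat) \<Rightarrow> (nat \<times> nat) set graph" where
  "cycle_ring k n x y =
     identify {((i, y i), (Suc i mod k, x (Suc i mod k))) | i. i < k}
       (disjoint_union {..<k} (\<lambda>i. cycle_graph (2 * n i)))"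

definition in_family_E :: "'a graph \<Rightarrow> bool" where
  "in_family_E G \<longleftrightarrow> (\<exists>k n x y. k \<ge> 3 \<and>
     (\<forall>i<k. n i \<ge> 2 \<and> x i \<in> verts (cycle_graph (2 * n i)) \<and>
        y i \<in> verts (cycle_graph (2 * n i)) \<and> x i \<noteq> y i) \<and>
     odd (\<Sum>i<k. graph_dist (cycle_graph (2 * n i)) (x i) (y i)) \<and>
     isomorphic (cycle_ring k n x y) G)"

end

theory Submission
  imports Defs
begin

text \<open>
  Write \<open>E\<close> for the set of edges. By \<open>critical_iff\<close>, a 3-colourable graph is critical when no single
  edge meets all odd cycles, while every edge \<open>e\<close> has a partner \<open>f\<close> such that \<open>E - {e, f}\<close> is
  two-colourable. The proof works in the cycle space, that is, with the sets of edges in which all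
  degrees are even. In a two-colouring of \<open>E - {e, f}\<close> the bad edges are exactly \<open>e\<close> and \<open>f\<close>, and an
  even-degree set has an even number of edges between different colours. Hence (\<open>odd_iff_one_partner\<close>)
  an even-degree set is odd exactly when it contains one of two partners and not the other. Odd sets
  are therefore transversals of the pairs of partners, even sets are unions of such pairs, and since
  every odd set contains an odd cycle, which is again a transversal, the odd sets are precisely the
  odd cycles.

  Suppose that a vertex \<open>u\<close> has odd degree. Every edge lies on half of the odd cycles, and by counting
  some odd cycle \<open>C\<close> avoids \<open>u\<close>. Outside \<open>C\<close> there is no cycle: an even one would meet \<open>C\<close> as a union
  of pairs of partners, and an odd one would be the complement of \<open>C\<close>, so that all degrees would be
  even. Three edges at \<open>u\<close> thus extend to three paths that share only \<open>u\<close> and end in distinct vertices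
  of \<open>C\<close>. The first and the second path form an even set with a suitable arc of \<open>C\<close>, and so do the
  second and the third. These two arcs cover \<open>C\<close>, because membership in them can change at three
  vertices only (\<open>two_arcs_cover\<close>). Being closed under partners, the two even sets cover all edges, so
  the graph is a subdivision of the complete graph on four vertices and has at most four odd cycles
  (\<open>card_odd_sets_odd_degree\<close>).

  With at least five odd cycles, then, all degrees are even and the complement of an odd cycle \<open>C\<close> is an
  odd cycle \<open>C'\<close>. An odd cycle is determined by the arcs of \<open>C\<close> between consecutive common vertices
  that it contains, so there are at least three common vertices. For every such arc \<open>P\<close>, one of the
  two arcs of \<open>C'\<close> with the same ends has the parity of \<open>P\<close>; call it \<open>Q\<close>. Since \<open>P \<union> Q\<close> is an even
  set, \<open>Q\<close> consists of the partners of \<open>P\<close>. So the arcs \<open>Q\<close> partition \<open>C'\<close>, and none has a common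
  vertex in its interior, as exchanging \<open>P\<close> for \<open>Q\<close> in \<open>C\<close> gives an odd cycle again. The cycles
  \<open>P \<union> Q\<close> form the ring (\<open>ring_of_even_degrees\<close>).

  Conversely, in a ring a two-colouring that misses at most one edge alternates along every even
  cycle, which contradicts the odd sum of distances; a second deletion in the same cycle repairs this
  (\<open>two_colorable_minus_two\<close>). Adding even cycles of the ring to one odd set gives further odd sets,
  which are odd cycles by the first part (\<open>five_odd_cycles\<close>).
\<close>



abbreviation deg :: "'a set set \<Rightarrow> 'a \<Rightarrow> nat" where
  "deg F v \<equiv> card {e \<in> F. v \<in> e}"

definition even_degrees :: "'a set set \<Rightarrow> bool" where
  "even_degrees F \<longleftrightarrow> (\<forall>v. even (deg F v))"

definition two_colorable :: "'a set set \<Rightarrow> bool" where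
  "two_colorable F \<longleftrightarrow> (\<exists>c :: 'a \<Rightarrow> bool. \<forall>u v. {u, v} \<in> F \<longrightarrow> c u \<noteq> c v)"

definition path_edges :: "(nat \<Rightarrow> 'a) \<Rightarrow> nat \<Rightarrow> 'a set set" where
  "path_edges \<delta> p = (\<lambda>j. {\<delta> j, \<delta> (Suc j)}) ` {..<p}"

definition cycle_edges :: "(nat \<Rightarrow> 'a) \<Rightarrow> nat \<Rightarrow> 'a set set" where
  "cycle_edges \<gamma> m = (\<lambda>j. {\<gamma> j, \<gamma> (Suc j mod m)}) ` {..<m}"

definition is_cycle :: "'a set set \<Rightarrow> bool" where
  "is_cycle F \<longleftrightarrow> (\<exists>\<gamma> m. m \<ge> 3 \<and> inj_on \<gamma> {..<m} \<and> F = cycle_edges \<gamma> m)"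

section \<open>Degrees modulo two\<close>

lemma even_card_sym_diff:
  assumes "finite A" "finite B"
  shows "even (card (sym_diff A B)) \<longleftrightarrow> (even (card A) \<longleftrightarrow> even (card B))"
proof -
  have a: "card A = card (A \<inter> B) + card (A - B)" using assms(1) by (rule card_Int_Diff)
  have b: "card B = card (B \<inter> A) + card (B - A)" using assms(2) by (rule card_Int_Diff)
  have c: "card (sym_diff A B) = card (A - B) + card (B - A)"
    using assms by (intro card_Un_disjoint) auto
  show ?thesis unfolding a b c by (auto simp: Int_commute)
qed

lemma even_deg_sym_diff:
  assumes "finite A" "finite B"
  shows "even (deg (sym_diff A B) v) \<longleftrightarrow> (even (deg A v) \<longleftrightarrow> even (deg B v))"
proof -
  have "{e \<in> sym_diff A B. v \<in> e} = sym_diff {e \<in> A. v \<in> e} {e \<in> B. v \<in> e}" by auto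
  then show ?thesis using even_card_sym_diff[of "{e \<in> A. v \<in> e}" "{e \<in> B. v \<in> e}"] assms by simp
qed

lemma even_degrees_sym_diffI:
  assumes "finite A" "finite B" "\<And>v. odd (deg A v) \<longleftrightarrow> odd (deg B v)"
  shows "even_degrees (sym_diff A B)"
  unfolding even_degrees_def
proof
  fix v
  show "even (deg (sym_diff A B) v)"
    using even_deg_sym_diff[OF assms(1,2), of v] assms(3)[of v] by blast
qed

lemma even_degrees_sym_diff:
  assumes "finite A" "finite B" "even_degrees A" "even_degrees B"
  shows "even_degrees (sym_diff A B)"
  unfolding even_degrees_def
proof
  fix v
  show "even (deg (sym_diff A B) v)"
    using even_deg_sym_diff[OF assms(1,2), of v] assms(3,4) unfolding even_degrees_def by blast
qed

text \<open>Count the pairs of a vertex with \<open>c v\<close> and an edge at it in two ways: an edge contributes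
  an odd number exactly when its ends have different colours.\<close>

lemma even_bichromatic:
  fixes c :: "'a \<Rightarrow> bool"
  assumes fin: "finite Z" and two: "\<And>e. e \<in> Z \<Longrightarrow> card e = 2" and ev: "even_degrees Z"
  shows "even (card {e \<in> Z. \<exists>u\<in>e. \<exists>v\<in>e. c u \<noteq> c v})"
proof -
  define W where "W = {v \<in> \<Union>Z. c v}"
  have finW: "finite W"
    unfolding W_def using fin two by (metis (no_types, lifting) card.infinite finite_Union finite_subset mem_Collect_eq subsetI zero_neq_numeral)
  have "(\<Sum>e\<in>Z. card {v\<in>W. v \<in> e}) = (\<Sum>v\<in>W. deg Z v)"
    by (rule sum_multicount_gen) (use fin finW in auto)
  moreover have "even (\<Sum>v\<in>W. deg Z v)"
    using ev unfolding even_degrees_def by (auto intro: dvd_sum)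
  ultimately have "even (card {e\<in>Z. odd (card {v\<in>W. v \<in> e})})"
    using even_sum_iff[OF fin, of "\<lambda>e. card {v\<in>W. v \<in> e}"] by simp
  moreover have "odd (card {v\<in>W. v \<in> e}) \<longleftrightarrow> (\<exists>u\<in>e. \<exists>v\<in>e. c u \<noteq> c v)" if "e \<in> Z" for e
  proof -
    obtain u v where e: "e = {u, v}" "u \<noteq> v" using two \<open>e \<in> Z\<close> by (meson card_2_iff)
    have "{x\<in>W. x \<in> e} = (if c u then {u} else {}) \<union> (if c v then {v} else {})"
      unfolding W_def using that e by auto
    then show ?thesis using e by auto
  qed
  ultimately show ?thesis by (simp cong: conj_cong Collect_cong)
qed

section \<open>Paths and cycles as edge sets\<close>

lemma path_edges_Suc: "path_edges \<delta> (Suc p) = insert {\<delta> p, \<delta> (Suc p)} (path_edges \<delta> p)"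
  unfolding path_edges_def by (simp add: lessThan_Suc)

lemma path_edges_cong: "(\<And>j. j \<le> p \<Longrightarrow> \<delta> j = \<delta>' j) \<Longrightarrow> path_edges \<delta> p = path_edges \<delta>' p"
  unfolding path_edges_def by (rule image_cong) auto

lemma finite_path_edges [simp]: "finite (path_edges \<delta> p)"
  unfolding path_edges_def by simp

lemma finite_cycle_edges [simp]: "finite (cycle_edges \<gamma> m)"
  unfolding cycle_edges_def by simp

lemma path_edges_mono: "p \<le> q \<Longrightarrow> path_edges \<delta> p \<subseteq> path_edges \<delta> q"
  unfolding path_edges_def by auto

lemma Union_path_edges: "\<Union>(path_edges \<delta> p) \<subseteq> \<delta> ` {..p}"
  unfolding path_edges_def by auto

lemma path_edges_rev: "path_edges (\<lambda>j. \<delta> (p - j)) p = path_edges \<delta> p"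
proof -
  have "{\<delta> (p - j), \<delta> (p - Suc j)} \<in> path_edges \<delta> p" if "j < p" for j
  proof -
    have "{\<delta> (p - j), \<delta> (p - Suc j)} = {\<delta> (p - Suc j), \<delta> (Suc (p - Suc j))}"
      using that by (auto simp: Suc_diff_Suc)
    then show ?thesis unfolding path_edges_def using that by (intro image_eqI[of _ _ "p - Suc j"]) auto
  qed
  moreover have "{\<delta> j, \<delta> (Suc j)} \<in> path_edges (\<lambda>j. \<delta> (p - j)) p" if "j < p" for j
    unfolding path_edges_def using that
    by (intro image_eqI[of _ _ "p - Suc j"]) (auto simp: Suc_diff_Suc)
  ultimately show ?thesis unfolding path_edges_def by blast
qed

lemma path_edge_inj:
  assumes "inj_on \<delta> {..p}" "i < p" "j < p" "{\<delta> i, \<delta> (Suc i)} = {\<delta> j, \<delta> (Suc j)}"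
  shows "i = j"
proof -
  have "\<delta> x = \<delta> y \<longleftrightarrow> x = y" if "x \<le> p" "y \<le> p" for x y
    using assms(1) that by (meson atMost_iff inj_onD)
  then show ?thesis using assms(2-4) by (auto simp: doubleton_eq_iff)
qed

lemma card_path_edges: "inj_on \<delta> {..p} \<Longrightarrow> card (path_edges \<delta> p) = p"
  unfolding path_edges_def
  by (subst card_image) (auto intro!: inj_onI dest: path_edge_inj)

lemma deg_path_edges:
  assumes "inj_on \<delta> {..p}"
  shows "odd (deg (path_edges \<delta> p) v) \<longleftrightarrow> p > 0 \<and> (v = \<delta> 0 \<or> v = \<delta> p)"
  using assms
proof (induction p)
  case 0
  then show ?case by (simp add: path_edges_def)
next
  case (Suc p)
  have inj: "\<delta> x = \<delta> y \<longleftrightarrow> x = y" if "x \<le> Suc p" "y \<le> Suc p" for x y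
    using Suc.prems that by (meson atMost_iff inj_onD)
  have new: "{\<delta> p, \<delta> (Suc p)} \<notin> path_edges \<delta> p"
  proof
    assume "{\<delta> p, \<delta> (Suc p)} \<in> path_edges \<delta> p"
    then obtain j where "j < p" "{\<delta> p, \<delta> (Suc p)} = {\<delta> j, \<delta> (Suc j)}" unfolding path_edges_def by auto
    then show False using path_edge_inj[OF Suc.prems, of p j] by simp
  qed
  have IH: "odd (deg (path_edges \<delta> p) v) \<longleftrightarrow> p > 0 \<and> (v = \<delta> 0 \<or> v = \<delta> p)"
    using Suc.IH Suc.prems by (meson atMost_subset_iff inj_on_subset le_SucI order_refl)
  show ?case
  proof (cases "v \<in> {\<delta> p, \<delta> (Suc p)}")
    case True
    then have "{e \<in> path_edges \<delta> (Suc p). v \<in> e} = insert {\<delta> p, \<delta> (Suc p)} {e \<in> path_edges \<delta> p. v \<in> e}"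
      unfolding path_edges_Suc by auto
    then have "deg (path_edges \<delta> (Suc p)) v = Suc (deg (path_edges \<delta> p) v)" using new by simp
    then show ?thesis using IH True inj by auto
  next
    case False
    then have "{e \<in> path_edges \<delta> (Suc p). v \<in> e} = {e \<in> path_edges \<delta> p. v \<in> e}"
      unfolding path_edges_Suc by auto
    then show ?thesis using IH False by auto
  qed
qed

lemma path_edges_at_interior:
  assumes "inj_on \<delta> {..p}" "0 < j" "j < p"
  shows "{e \<in> path_edges \<delta> p. \<delta> j \<in> e} = {{\<delta> (j - 1), \<delta> j}, {\<delta> j, \<delta> (Suc j)}}" (is "?l = ?r")
    and "{\<delta> (j - 1), \<delta> j} \<noteq> {\<delta> j, \<delta> (Suc j)}"
proof -
  have inj: "\<delta> x = \<delta> y \<longleftrightarrow> x = y" if "x \<le> p" "y \<le> p" for x y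
    using assms(1) that by (meson atMost_iff inj_onD)
  have "e \<in> ?r" if "e \<in> ?l" for e
  proof -
    obtain i where i: "i < p" "e = {\<delta> i, \<delta> (Suc i)}" using \<open>e \<in> ?l\<close> unfolding path_edges_def by auto
    then have "i = j \<or> Suc i = j" using \<open>e \<in> ?l\<close> assms inj by auto
    then show ?thesis using i by auto
  qed
  moreover have "?r \<subseteq> ?l"
    using assms unfolding path_edges_def
    by (auto intro: image_eqI[of _ _ j] image_eqI[of _ _ "j - 1"])
  ultimately show "?l = ?r" by blast
  show "{\<delta> (j - 1), \<delta> j} \<noteq> {\<delta> j, \<delta> (Suc j)}"
    using inj[of "j - 1" j] inj[of "j - 1" "Suc j"] assms by (auto simp: doubleton_eq_iff)
qed

lemma cycle_edges_path: 
  assumes "p \<ge> 1"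
  shows "cycle_edges \<delta> (Suc p) = insert {\<delta> p, \<delta> 0} (path_edges \<delta> p)"
proof -
  have "(\<lambda>j. {\<delta> j, \<delta> (Suc j mod Suc p)}) ` {..<p} = path_edges \<delta> p"
    unfolding path_edges_def by (rule image_cong) auto
  then show ?thesis unfolding cycle_edges_def by (simp add: lessThan_Suc)
qed

lemma path_closing_edge:
  assumes "inj_on \<delta> {..p}" "{\<delta> p, \<delta> 0} \<notin> path_edges \<delta> p" "\<delta> 0 \<noteq> \<delta> p"
  shows "p \<ge> 2" "is_cycle (insert {\<delta> p, \<delta> 0} (path_edges \<delta> p))"
proof -
  have "p \<noteq> 0" using assms(3) by metis
  moreover have "p \<noteq> 1" using assms(2) unfolding path_edges_def by (auto simp: insert_commute)
  ultimately show p: "p \<ge> 2" by simp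
  then show "is_cycle (insert {\<delta> p, \<delta> 0} (path_edges \<delta> p))"
    unfolding is_cycle_def using cycle_edges_path[of p \<delta>] assms(1)
    by (intro exI[of _ \<delta>] exI[of _ "Suc p"]) (auto simp: lessThan_Suc_atMost)
qed

lemma cycle_edges_rotate:
  assumes "inj_on \<gamma> {..<m}" "m > 0"
  shows "inj_on (\<lambda>j. \<gamma> ((j + a) mod m)) {..<m}" (is ?A)
    and "cycle_edges (\<lambda>j. \<gamma> ((j + a) mod m)) m = cycle_edges \<gamma> m" (is ?B)
    and "(\<lambda>j. \<gamma> ((j + a) mod m)) ` {..<m} = \<gamma> ` {..<m}" (is ?C)
proof -
  let ?r = "\<lambda>j. (j + a) mod m"
  have injr: "inj_on ?r {..<m}"
  proof -
    have le: "x = y" if "x \<le> y" "y < m" "?r x = ?r y" for x y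
    proof -
      have "m dvd (y + a) - (x + a)" using that mod_eq_dvd_iff_nat[of "x + a" "y + a" m] by simp
      then have "\<not> 0 < y - x" using that(2) by (auto dest: dvd_imp_le)
      then show ?thesis using that(1) by simp
    qed
    show ?thesis by (rule inj_onI) (metis le lessThan_iff nat_le_linear)
  qed
  have imr: "?r ` {..<m} = {..<m}"
    using assms(2) by (intro endo_inj_surj injr) auto
  show ?A using comp_inj_on[OF injr, of \<gamma>] assms(1) imr by (simp add: comp_def)
  show ?C using imr by (metis image_image)
  have "cycle_edges (\<lambda>j. \<gamma> ((j + a) mod m)) m = (\<lambda>j. {\<gamma> (?r j), \<gamma> (Suc (?r j) mod m)}) ` {..<m}"
    unfolding cycle_edges_def by (intro image_cong) (auto simp: mod_simps)
  also have "\<dots> = (\<lambda>j. {\<gamma> j, \<gamma> (Suc j mod m)}) ` (?r ` {..<m})" by (simp add: image_image)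
  finally show ?B unfolding imr cycle_edges_def .
qed

lemma cycle_startE:
  assumes "is_cycle F" "v \<in> \<Union>F"
  obtains \<gamma> p where "p \<ge> 2" "inj_on \<gamma> {..p}" "F = insert {\<gamma> p, \<gamma> 0} (path_edges \<gamma> p)" "\<gamma> 0 = v" 
proof -
  obtain \<gamma> m where g: "m \<ge> 3" "inj_on \<gamma> {..<m}" "F = cycle_edges \<gamma> m"
    using assms(1) unfolding is_cycle_def by blast
  have "m > 0" using g(1) by simp
  then have "\<Union>F \<subseteq> \<gamma> ` {..<m}"
    unfolding g(3) cycle_edges_def by (auto intro!: imageI)
  then obtain a where a: "a < m" "v = \<gamma> a" using assms(2) by auto
  let ?g = "\<lambda>j. \<gamma> ((j + a) mod m)"
  have eq: "Suc (m - 1) = m" using g by simp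
  show thesis
  proof (rule that[of "m - 1" ?g])
    show "inj_on ?g {..m - 1}"
      using cycle_edges_rotate(1)[OF g(2), of a] g(1) eq by (metis lessThan_Suc_atMost zero_less_Suc)
    show "F = insert {?g (m - 1), ?g 0} (path_edges ?g (m - 1))"
      using cycle_edges_rotate(2)[OF g(2), of a] g cycle_edges_path[of "m - 1" ?g] eq by auto
  qed (use g a in auto)
qed

lemma closing_edge_notin:
  assumes "inj_on \<delta> {..p}" "p \<ge> 2"
  shows "{\<delta> p, \<delta> 0} \<notin> path_edges \<delta> p"
proof
  have inj: "\<delta> x = \<delta> y \<longleftrightarrow> x = y" if "x \<le> p" "y \<le> p" for x y
    using assms(1) that by (meson atMost_iff inj_onD)
  assume "{\<delta> p, \<delta> 0} \<in> path_edges \<delta> p"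
  then obtain j where "j < p" "{\<delta> p, \<delta> 0} = {\<delta> j, \<delta> (Suc j)}" unfolding path_edges_def by auto
  then show False using inj assms(2) by (auto simp: doubleton_eq_iff)
qed

lemma card_cycle_edges:
  assumes "m \<ge> 3" "inj_on \<gamma> {..<m}"
  shows "card (cycle_edges \<gamma> m) = m"
proof -
  obtain p where p: "m = Suc p" "p \<ge> 2" using assms(1) by (cases m) auto
  then have "inj_on \<gamma> {..p}" using assms(2) by (simp add: lessThan_Suc_atMost)
  then show ?thesis
    using p cycle_edges_path[of p \<gamma>] card_path_edges[of \<gamma> p] closing_edge_notin[of \<gamma> p] by simp
qed

lemma cycle_edge_inj:
  assumes "m \<ge> 3" "inj_on \<gamma> {..<m}" "i < m" "j < m" "{\<gamma> i, \<gamma> (Suc i mod m)} = {\<gamma> j, \<gamma> (Suc j mod m)}"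
  shows "i = j"
proof -
  have "inj_on (\<lambda>j. {\<gamma> j, \<gamma> (Suc j mod m)}) {..<m}"
    using card_cycle_edges[OF assms(1,2)] unfolding cycle_edges_def by (intro eq_card_imp_inj_on) auto
  then show ?thesis using assms(3-5) by (auto dest: inj_onD)
qed

lemma cycle_edges_two_paths:
  assumes "\<delta> 0 = \<rho> 0" "\<delta> p = \<rho> q" "0 < p" "0 < q"
  shows "cycle_edges (\<lambda>j. if j \<le> p then \<delta> j else \<rho> (p + q - j)) (p + q) = path_edges \<delta> p \<union> path_edges \<rho> q"
proof -
  let ?f = "\<lambda>j. if j \<le> p then \<delta> j else \<rho> (p + q - j)"
  have "{..<p + q} = {..<p} \<union> (\<lambda>i. p + i) ` {..<q}"
  proof -
    have "x \<in> {..<p} \<or> x \<in> (\<lambda>i. p + i) ` {..<q}" if "x < p + q" for x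
      using that by (cases "x < p") (auto intro: image_eqI[of _ _ "x - p"])
    then show ?thesis by auto
  qed
  then have "cycle_edges ?f (p + q) = (\<lambda>j. {?f j, ?f (Suc j mod (p + q))}) ` {..<p} \<union>
      (\<lambda>i. {?f (p + i), ?f (Suc (p + i) mod (p + q))}) ` {..<q}"
    unfolding cycle_edges_def by (simp only: image_Un image_image)
  also have "(\<lambda>j. {?f j, ?f (Suc j mod (p + q))}) ` {..<p} = path_edges \<delta> p"
    unfolding path_edges_def using assms(4) by (intro image_cong) auto
  also have "(\<lambda>i. {?f (p + i), ?f (Suc (p + i) mod (p + q))}) ` {..<q} = path_edges (\<lambda>j. \<rho> (q - j)) q"
    unfolding path_edges_def
  proof (rule image_cong)
    fix i assume "i \<in> {..<q}"
    then have i: "i < q" by simp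
    have "?f (p + i) = \<rho> (q - i)" using assms(2) by (cases i) auto
    moreover have "?f (Suc (p + i) mod (p + q)) = \<rho> (q - Suc i)"
    proof (cases "Suc i = q")
      case True
      then have "Suc (p + i) mod (p + q) = 0" by (metis add_Suc_right mod_self)
      then show ?thesis using assms(1) True by simp
    next
      case False
      then have "Suc (p + i) mod (p + q) = Suc (p + i)" using i by simp
      then show ?thesis by simp
    qed
    ultimately show "{?f (p + i), ?f (Suc (p + i) mod (p + q))} = {\<rho> (q - i), \<rho> (q - Suc i)}" by simp
  qed simp
  finally show ?thesis unfolding path_edges_rev .
qed

lemma cycle_edges_at:
  assumes "m \<ge> 3" "inj_on \<gamma> {..<m}" "0 < j" "j < m"
  shows "{e \<in> cycle_edges \<gamma> m. \<gamma> j \<in> e} \<subseteq> {{\<gamma> (j - 1), \<gamma> j}, {\<gamma> j, \<gamma> (Suc j mod m)}}"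
proof
  fix e assume "e \<in> {e \<in> cycle_edges \<gamma> m. \<gamma> j \<in> e}"
  then obtain i where i: "i < m" "e = {\<gamma> i, \<gamma> (Suc i mod m)}" "\<gamma> j \<in> e" unfolding cycle_edges_def by auto
  have "Suc i mod m < m" using i(1) by simp
  then have "j = i \<or> j = Suc i mod m" using i assms(2,4) by (auto dest: inj_onD)
  then have "j = i \<or> j = Suc i" using assms(3) i(1) by (auto simp: mod_Suc split: if_splits)
  then show "e \<in> {{\<gamma> (j - 1), \<gamma> j}, {\<gamma> j, \<gamma> (Suc j mod m)}}" using i(2) assms(4) by auto
qed

lemma cycle_deg:
  assumes "is_cycle F"
  shows "deg F v = (if v \<in> \<Union>F then 2 else 0)"
proof (cases "v \<in> \<Union>F")
  case True
  obtain \<gamma> p where g: "p \<ge> 2" "inj_on \<gamma> {..p}" "F = insert {\<gamma> p, \<gamma> 0} (path_edges \<gamma> p)" "\<gamma> 0 = v"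
    using cycle_startE[OF assms True] by metis
  have inj: "\<gamma> x = \<gamma> y \<longleftrightarrow> x = y" if "x \<le> p" "y \<le> p" for x y
    using g(2) that by (meson atMost_iff inj_onD)
  have "{e \<in> path_edges \<gamma> p. v \<in> e} = {{\<gamma> 0, \<gamma> 1}}"
    using g(1,4) inj unfolding path_edges_def by auto
  then have "{e \<in> F. v \<in> e} = {{\<gamma> p, \<gamma> 0}, {\<gamma> 0, \<gamma> 1}}" using g(3,4) by auto
  moreover have "{\<gamma> p, \<gamma> 0} \<noteq> {\<gamma> 0, \<gamma> 1}" using inj g(1) by (auto simp: doubleton_eq_iff)
  ultimately show ?thesis using True by simp
next
  case False
  then have "{e \<in> F. v \<in> e} = {}" by auto
  then have "deg F v = 0" by (metis card.empty)
  then show ?thesis using False by simp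
qed

lemma cycle_even_degrees: "is_cycle F \<Longrightarrow> even_degrees F"
  unfolding even_degrees_def by (simp add: cycle_deg)

lemma cycle_finite: "is_cycle F \<Longrightarrow> finite F"
  unfolding is_cycle_def by auto

lemma cycle_nonempty: "is_cycle F \<Longrightarrow> F \<noteq> {}"
  unfolding is_cycle_def cycle_edges_def by (auto simp: lessThan_empty_iff)

lemma cycle_arcs:
  assumes "is_cycle F" "u \<in> \<Union>F" "v \<in> \<Union>F" "u \<noteq> v"
  obtains \<delta> p \<delta>' p' where
    "inj_on \<delta> {..p}" "\<delta> 0 = u" "\<delta> p = v" "inj_on \<delta>' {..p'}" "\<delta>' 0 = u" "\<delta>' p' = v"
    "p > 0" "p' > 0"
    "path_edges \<delta> p \<inter> path_edges \<delta>' p' = {}" "path_edges \<delta> p \<union> path_edges \<delta>' p' = F"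
proof -
  obtain \<gamma> q where g: "q \<ge> 2" "inj_on \<gamma> {..q}" "F = insert {\<gamma> q, \<gamma> 0} (path_edges \<gamma> q)" "\<gamma> 0 = u"
    using cycle_startE[OF assms(1,2)] by metis
  obtain b where b: "b \<le> q" "v = \<gamma> b"
    using assms(3) g(3) Union_path_edges[of \<gamma> q] by auto
  have b0: "b > 0" using b g(4) assms(4) by (cases b) auto
  have inj: "\<gamma> x = \<gamma> y \<longleftrightarrow> x = y" if "x \<le> q" "y \<le> q" for x y
    using g(2) that by (meson atMost_iff inj_onD)
  define \<delta>' where "\<delta>' = (\<lambda>j. if j = 0 then \<gamma> 0 else \<gamma> (Suc q - j))"
  have d0: "\<delta>' 0 = u" and dj: "\<delta>' (Suc j) = \<gamma> (q - j)" for j using g(4) by (auto simp: \<delta>'_def)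
  have pe: "path_edges \<delta>' (Suc q - b) = insert {\<gamma> q, \<gamma> 0} ((\<lambda>j. {\<gamma> j, \<gamma> (Suc j)}) ` {b..<q})"
  proof -
    have "{..<Suc q - b} = insert 0 (Suc ` {..<q - b})" 
      using b(1) by (auto simp: image_iff less_Suc_eq_0_disj Suc_diff_le)
    then have "path_edges \<delta>' (Suc q - b) = insert {\<gamma> 0, \<gamma> q} ((\<lambda>j. {\<gamma> (q - j), \<gamma> (q - Suc j)}) ` {..<q - b})"
      unfolding path_edges_def by (simp add: image_image dj) (simp add: d0 g(4))
    also have "(\<lambda>j. {\<gamma> (q - j), \<gamma> (q - Suc j)}) ` {..<q - b} = (\<lambda>j. {\<gamma> j, \<gamma> (Suc j)}) ` {b..<q}"
    proof -
      have "{\<gamma> (q - j), \<gamma> (q - Suc j)} = {\<gamma> (q - Suc j), \<gamma> (Suc (q - Suc j))}" if "j < q - b" for j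
        using that by (auto simp: Suc_diff_Suc)
      then have "(\<lambda>j. {\<gamma> (q - j), \<gamma> (q - Suc j)}) ` {..<q - b} = (\<lambda>j. {\<gamma> j, \<gamma> (Suc j)}) ` ((\<lambda>j. q - Suc j) ` {..<q - b})"
        unfolding image_image by (intro image_cong) auto
      also have "(\<lambda>j. q - Suc j) ` {..<q - b} = {b..<q}"
      proof -
        have "x \<in> (\<lambda>j. q - Suc j) ` {..<q - b}" if "x \<in> {b..<q}" for x
          using that by (intro image_eqI[of _ _ "q - Suc x"]) auto
        then show ?thesis by auto
      qed
      finally show ?thesis .
    qed
    finally show ?thesis by (simp add: insert_commute)
  qed
  have spl: "path_edges \<gamma> q = path_edges \<gamma> b \<union> (\<lambda>j. {\<gamma> j, \<gamma> (Suc j)}) ` {b..<q}"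
  proof -
    have "{..<q} = {..<b} \<union> {b..<q}" using b(1) by auto
    then show ?thesis unfolding path_edges_def by (simp add: image_Un)
  qed
  show thesis
  proof (rule that[of \<gamma> b \<delta>' "Suc q - b"])
    show "inj_on \<gamma> {..b}" using g(2) b(1) by (meson atMost_subset_iff inj_on_subset)
    show "inj_on \<delta>' {..Suc q - b}"
      by (rule inj_onI) (use b(1) b0 inj in \<open>auto simp: \<delta>'_def split: if_splits\<close>)
    show "path_edges \<gamma> b \<union> path_edges \<delta>' (Suc q - b) = F"
      unfolding pe g(3) spl by auto
    have "{\<gamma> j, \<gamma> (Suc j)} \<notin> path_edges \<gamma> b" if "j \<in> {b..<q}" for j
    proof
      assume "{\<gamma> j, \<gamma> (Suc j)} \<in> path_edges \<gamma> b"
      then obtain i where "i < b" "{\<gamma> j, \<gamma> (Suc j)} = {\<gamma> i, \<gamma> (Suc i)}" unfolding path_edges_def by auto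
      then show False using path_edge_inj[OF g(2), of j i] that b(1) by auto
    qed
    moreover have "{\<gamma> q, \<gamma> 0} \<notin> path_edges \<gamma> b"
      using closing_edge_notin[OF g(2,1)] path_edges_mono[OF b(1), of \<gamma>] by blast
    ultimately show "path_edges \<gamma> b \<inter> path_edges \<delta>' (Suc q - b) = {}"
      unfolding pe by blast
    show "\<delta>' (Suc q - b) = v" using b b0 by (auto simp: \<delta>'_def)
  qed (use g b b0 d0 in auto)
qed

section \<open>Connectivity, parity and the existence of cycles\<close>

text \<open>\<open>S\<close> consists of the vertices that paths from \<open>a\<close> reach: a path to one end of an edge either
  extends to the other end or already passes through it.\<close>

lemma path_or_separation:
  assumes "\<And>e. e \<in> F \<Longrightarrow> card e = 2"
  obtains (path) \<delta> p where "inj_on \<delta> {..p}" "\<delta> 0 = a" "\<delta> p = b" "path_edges \<delta> p \<subseteq> F"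
  | (sep) S where "a \<in> S" "b \<notin> S" "\<And>e. e \<in> F \<Longrightarrow> e \<subseteq> S \<or> e \<inter> S = {}"
proof -
  define S where "S = {v. \<exists>\<delta> p. inj_on \<delta> {..p} \<and> \<delta> 0 = a \<and> \<delta> p = v \<and> path_edges \<delta> p \<subseteq> F}"
  have step: "y \<in> S" if "x \<in> S" "{x, y} \<in> F" for x y
  proof -
    obtain \<delta> p where d: "inj_on \<delta> {..p}" "\<delta> 0 = a" "\<delta> p = x" "path_edges \<delta> p \<subseteq> F"
      using \<open>x \<in> S\<close> unfolding S_def by auto
    show ?thesis
    proof (cases "y \<in> \<delta> ` {..p}")
      case True
      then obtain q where q: "q \<le> p" "y = \<delta> q" by auto
      have "inj_on \<delta> {..q}" using d(1) q(1) by (meson atMost_subset_iff inj_on_subset)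
      moreover have "path_edges \<delta> q \<subseteq> F" using d(4) path_edges_mono[OF q(1)] by blast
      ultimately show ?thesis unfolding S_def using d(2) q(2) by blast
    next
      case False
      let ?d = "\<delta>(Suc p := y)"
      have "inj_on ?d {..Suc p}" using d(1) False by (auto simp: atMost_Suc inj_on_def)
      moreover have "path_edges ?d (Suc p) \<subseteq> F"
        using d(3,4) that(2) path_edges_cong[of p ?d \<delta>] unfolding path_edges_Suc by auto
      moreover have "?d 0 = a" "?d (Suc p) = y" using d(2) by auto
      ultimately show ?thesis unfolding S_def by blast
    qed
  qed
  show thesis
  proof (cases "b \<in> S")
    case True
    then show thesis using path unfolding S_def by blast
  next
    case False
    have "inj_on (\<lambda>_::nat. a) {..0}" "path_edges (\<lambda>_. a) 0 \<subseteq> F" by (auto simp: path_edges_def)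
    then have "a \<in> S" unfolding S_def by blast
    moreover have "e \<subseteq> S \<or> e \<inter> S = {}" if "e \<in> F" for e
    proof -
      obtain x y where "e = {x, y}" using assms[OF \<open>e \<in> F\<close>] by (meson card_2_iff)
      then show ?thesis using step[of x y] step[of y x] that by (auto simp: insert_commute)
    qed
    ultimately show thesis using sep False by blast
  qed
qed

text \<open>If the other edges did not connect the ends of the given edge, that edge would be the only
  one leaving a set of vertices, against \<open>even_bichromatic\<close>.\<close>

lemma even_degrees_path:
  assumes "finite F" "\<And>e. e \<in> F \<Longrightarrow> card e = 2" "even_degrees F" "{a, b} \<in> F"
  obtains \<delta> p where "inj_on \<delta> {..p}" "\<delta> 0 = a" "\<delta> p = b" "path_edges \<delta> p \<subseteq> F - {{a, b}}"
proof (rule path_or_separation[of "F - {{a, b}}" a b])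
  fix S assume S: "a \<in> S" "b \<notin> S" "\<And>e. e \<in> F - {{a, b}} \<Longrightarrow> e \<subseteq> S \<or> e \<inter> S = {}"
  have "{e \<in> F. \<exists>u\<in>e. \<exists>v\<in>e. (u \<in> S) \<noteq> (v \<in> S)} = {{a, b}}"
    using S assms(4) by blast
  then have False using even_bichromatic[OF assms(1-3), of "\<lambda>v. v \<in> S"] by simp
  then show thesis ..
qed (use assms(2) that in auto)

lemma even_degrees_contains_cycle:
  assumes "finite F" "\<And>e. e \<in> F \<Longrightarrow> card e = 2" "even_degrees F" "F \<noteq> {}"
  obtains Z where "is_cycle Z" "Z \<subseteq> F"
proof -
  obtain a b where ab: "{a, b} \<in> F" "a \<noteq> b" using assms(2,4) by (metis card_2_iff ex_in_conv)
  obtain \<delta> p where d: "inj_on \<delta> {..p}" "\<delta> 0 = a" "\<delta> p = b" "path_edges \<delta> p \<subseteq> F - {{a, b}}"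
    using even_degrees_path[OF assms(1-3) ab(1)] by metis
  then have "is_cycle (insert {\<delta> p, \<delta> 0} (path_edges \<delta> p))"
    using ab by (intro path_closing_edge) (auto simp: insert_commute)
  then show thesis using that[of "insert {\<delta> p, \<delta> 0} (path_edges \<delta> p)"] d ab by (auto simp: insert_commute)
qed

text \<open>Peel off cycles; their lengths add up to an odd number, so one of them is odd.\<close>

lemma odd_even_degrees_contains_odd_cycle:
  assumes "finite F" "\<And>e. e \<in> F \<Longrightarrow> card e = 2" "even_degrees F" "odd (card F)"
  shows "\<exists>Z. is_cycle Z \<and> odd (card Z) \<and> Z \<subseteq> F"
  using assms
proof (induction "card F" arbitrary: F rule: less_induct)
  case less
  have ne: "F \<noteq> {}" using less.prems(4) by auto
  obtain Z where Z: "is_cycle Z" "Z \<subseteq> F" using even_degrees_contains_cycle[OF less.prems(1-3) ne] by metis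
  show ?case
  proof (cases "odd (card Z)")
    case False
    have sd: "sym_diff F Z = F - Z" using Z(2) by auto
    have fz: "finite Z" using Z cycle_finite by auto
    have "card (F - Z) < card F"
      using Z cycle_nonempty less.prems(1) by (intro psubset_card_mono) blast+
    moreover have "even_degrees (F - Z)"
      using even_degrees_sym_diff[OF less.prems(1) fz less.prems(3) cycle_even_degrees[OF Z(1)]] sd by simp
    moreover have "odd (card (F - Z))"
      using even_card_sym_diff[OF less.prems(1) fz] sd False less.prems(4) by simp
    ultimately have "\<exists>Z'. is_cycle Z' \<and> odd (card Z') \<and> Z' \<subseteq> F - Z"
      using less.prems(1,2) by (intro less.hyps) auto
    then show ?thesis by blast
  qed (use Z in blast)
qed

text \<open>Add edges one at a time. When two-colourability is lost, the new edge joins two vertices of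
  the same colour that the older edges connect, since otherwise the colours could be exchanged on
  one side.\<close>

lemma not_two_colorable_contains_odd_cycle:
  assumes "finite F" "\<And>e. e \<in> F \<Longrightarrow> card e = 2" "\<not> two_colorable F"
  shows "\<exists>Z. is_cycle Z \<and> odd (card Z) \<and> Z \<subseteq> F"
  using assms
proof (induction F rule: finite_induct)
  case empty
  then show ?case by (simp add: two_colorable_def)
next
  case (insert e F)
  show ?case
  proof (cases "two_colorable F")
    case False
    then show ?thesis using insert by blast
  next
    case True
    then obtain c :: "'a \<Rightarrow> bool" where c: "\<And>u v. {u, v} \<in> F \<Longrightarrow> c u \<noteq> c v" unfolding two_colorable_def by blast
    obtain a b where e: "e = {a, b}" "a \<noteq> b" using insert.prems(1) by (metis card_2_iff insertI1)
    have same: "c' a = c' b" if "\<And>u v. {u, v} \<in> F \<Longrightarrow> c' u \<noteq> c' v" for c' :: "'a \<Rightarrow> bool"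
    proof (rule ccontr)
      assume "c' a \<noteq> c' b"
      then have "two_colorable (insert e F)" unfolding two_colorable_def e
        using that by (intro exI[of _ c']) (auto simp: doubleton_eq_iff)
      then show False using insert.prems(2) by blast
    qed
    show ?thesis
    proof (rule path_or_separation[of F a b])
      fix S assume S: "a \<in> S" "b \<notin> S" "\<And>e. e \<in> F \<Longrightarrow> e \<subseteq> S \<or> e \<inter> S = {}"
      have "(c u \<noteq> (u \<in> S)) \<noteq> (c v \<noteq> (v \<in> S))" if "{u, v} \<in> F" for u v
        using c[OF that] S(3)[OF that] by auto
      then have "(c a \<noteq> (a \<in> S)) = (c b \<noteq> (b \<in> S))" by (intro same) auto
      then show ?thesis using same[of c] c S(1,2) by blast
    next
      fix \<delta> p assume d: "inj_on \<delta> {..p}" "\<delta> 0 = a" "\<delta> p = b" "path_edges \<delta> p \<subseteq> F"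
      let ?Z = "insert e (path_edges \<delta> p)"
      have ne: "e \<notin> path_edges \<delta> p" using d(4) insert.hyps by blast
      have cyc: "is_cycle ?Z" using path_closing_edge(2)[OF d(1)] ne e d(2,3) by (simp add: insert_commute)
      have two: "\<And>x. x \<in> ?Z \<Longrightarrow> card x = 2" using insert.prems(1) d(4) by blast
      have "{x \<in> ?Z. \<exists>u\<in>x. \<exists>v\<in>x. c u \<noteq> c v} = path_edges \<delta> p"
        using same[of c] c d(4) e ne unfolding path_edges_def by blast
      then have "even (card (path_edges \<delta> p))"
        using even_bichromatic[OF cycle_finite[OF cyc] two cycle_even_degrees[OF cyc], of c] by metis
      then have "odd (card ?Z)" using ne by simp
      then show ?thesis using cyc d(4) by blast
    qed (use insert.prems in auto)
  qed
qed

lemma two_colorable_subset: "two_colorable F \<Longrightarrow> F' \<subseteq> F \<Longrightarrow> two_colorable F'"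
  unfolding two_colorable_def by blast


section \<open>Criticality in terms of two-colourings\<close>

lemma colorable_mono: "colorable G k \<Longrightarrow> k \<le> l \<Longrightarrow> colorable G l"
  unfolding colorable_def by (meson lessThan_subset_iff order_trans)

lemma colorable_2_iff:
  fixes G :: "'a graph"
  assumes "simple_graph G"
  shows "colorable G 2 \<longleftrightarrow> two_colorable (edges G)"
proof
  assume "colorable G 2"
  then obtain c :: "'a \<Rightarrow> nat" where c: "c ` verts G \<subseteq> {..<2}" "\<And>u v. {u, v} \<in> edges G \<Longrightarrow> c u \<noteq> c v"
    unfolding colorable_def by blast
  have "(c u = 0) \<noteq> (c v = 0)" if "{u, v} \<in> edges G" for u v
  proof -
    have "u \<in> verts G" "v \<in> verts G" using assms that unfolding simple_graph_def by auto
    then have "c u < 2" "c v < 2" using c(1) by auto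
    then show ?thesis using c(2)[OF that] by auto
  qed
  then show "two_colorable (edges G)" unfolding two_colorable_def by (intro exI[of _ "\<lambda>v. c v = 0"]) auto
next
  assume "two_colorable (edges G)"
  then obtain c :: "'a \<Rightarrow> bool" where "\<And>u v. {u, v} \<in> edges G \<Longrightarrow> c u \<noteq> c v"
    unfolding two_colorable_def by blast
  then show "colorable G 2"
    unfolding colorable_def by (intro exI[of _ "\<lambda>v. if c v then 1 else 0"]) auto
qed

lemma ex_colorable:
  assumes "simple_graph G"
  shows "\<exists>k. colorable G k"
proof -
  obtain c :: "'a \<Rightarrow> nat" and n where c: "c ` verts G = {i. i < n}" "inj_on c (verts G)"
    using finite_imp_inj_to_nat_seg[of "verts G"] assms unfolding simple_graph_def by metis
  have "c u \<noteq> c v" if "{u, v} \<in> edges G" for u v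
  proof -
    have "u \<in> verts G" "v \<in> verts G" "u \<noteq> v"
      using assms that unfolding simple_graph_def by (auto simp: card_insert_if split: if_splits)
    then show ?thesis using c(2) by (meson inj_onD)
  qed
  then show ?thesis unfolding colorable_def using c(1) by (intro exI[of _ n] exI[of _ c]) auto
qed

lemma chromatic_le_iff:
  assumes "simple_graph G"
  shows "chromatic_number G \<le> k \<longleftrightarrow> colorable G k"
  unfolding chromatic_number_def
  using ex_colorable[OF assms] by (metis LeastI Least_le colorable_mono)

lemma simple_delete: "simple_graph G \<Longrightarrow> simple_graph (delete_edges G F)"
  unfolding simple_graph_def delete_edges_def by auto

lemma edges_delete [simp]: "edges (delete_edges G F) = edges G - F"
  unfolding delete_edges_def by simp

lemma chromatic_lt_3_iff:
  assumes "simple_graph G"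
  shows "chromatic_number G < 3 \<longleftrightarrow> two_colorable (edges G)"
  using chromatic_le_iff[OF assms, of 2] colorable_2_iff[OF assms] by auto

lemma finite_edges: "simple_graph G \<Longrightarrow> finite (edges G)"
  unfolding simple_graph_def by (meson Pow_iff finite_Pow_iff finite_subset subsetI)

lemma edge_stability_le_iff:
  assumes "simple_graph G" "chromatic_number G = 3"
  shows "edge_stability G \<le> m \<longleftrightarrow>
    (\<exists>F\<subseteq>edges G. card F \<le> m \<and> two_colorable (edges G - F))"
proof -
  define P where "P m = (\<exists>F\<subseteq>edges G. card F = m \<and>
        chromatic_number (delete_edges G F) < chromatic_number G)" for m
  have P: "P m \<longleftrightarrow> (\<exists>F\<subseteq>edges G. card F = m \<and> two_colorable (edges G - F))" for m
    unfolding P_def assms(2) by (simp add: chromatic_lt_3_iff simple_delete assms(1))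
  have ex: "P (card (edges G))"
    unfolding P by (auto simp: two_colorable_def)
  have "edge_stability G = (LEAST m. P m)" unfolding edge_stability_def P_def by simp
  then have "edge_stability G \<le> m \<longleftrightarrow> (\<exists>l\<le>m. P l)"
    using ex by (metis LeastI Least_le order_trans)
  then show ?thesis unfolding P by auto
qed

lemma card_le_1_cases:
  assumes "finite A" shows "card A \<le> 1 \<longleftrightarrow> A = {} \<or> (\<exists>a. A = {a})"
proof
  assume "card A \<le> 1"
  then have "card A = 0 \<or> card A = 1" by auto
  then show "A = {} \<or> (\<exists>a. A = {a})" using assms by (auto simp: card_1_singleton_iff)
qed auto

text \<open>Deletion of an edge leaves the chromatic number three when no single deletion makes the graph
  two-colourable; the edge-stability number of the smaller graph is then below two exactly when one
  further deletion does.\<close>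

lemma critical_iff:
  assumes simple: "simple_graph G"
  shows "critical_3_2 G \<longleftrightarrow> colorable G 3 \<and> edges G \<noteq> {} \<and>
    (\<forall>e\<in>edges G. \<not> two_colorable (edges G - {e})) \<and>
    (\<forall>e\<in>edges G. \<exists>f\<in>edges G. two_colorable (edges G - {e, f}))"
    (is "?L \<longleftrightarrow> ?R")
proof -
  let ?E = "edges G"
  have fin: "finite ?E" using finite_edges[OF simple] .
  have chi: "chromatic_number H = 3 \<longleftrightarrow> colorable H 3 \<and> \<not> two_colorable (edges H)"
    if "simple_graph H" for H :: "'a graph"
    using chromatic_le_iff[OF that, of 3] chromatic_lt_3_iff[OF that] by auto
  have le1: "edge_stability H \<le> 1 \<longleftrightarrow> (\<exists>f\<in>edges H. two_colorable (edges H - {f}))"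
    if H: "simple_graph H" "chromatic_number H = 3" for H :: "'a graph"
  proof -
    have "\<not> two_colorable (edges H)" using chi[OF H(1)] H(2) by simp
    moreover have "edge_stability H \<le> 1 \<longleftrightarrow>
        (\<exists>F\<subseteq>edges H. (F = {} \<or> (\<exists>f. F = {f})) \<and> two_colorable (edges H - F))"
    proof -
      have "card F \<le> 1 \<longleftrightarrow> F = {} \<or> (\<exists>f. F = {f})" if "F \<subseteq> edges H" for F
        using card_le_1_cases[OF finite_subset[OF that finite_edges[OF H(1)]]] .
      then show ?thesis unfolding edge_stability_le_iff[OF H] by (simp cong: conj_cong)
    qed
    ultimately show ?thesis by (metis Diff_empty empty_subsetI insert_subset)
  qed
  have col_sub: "colorable (delete_edges G F) 3" if "colorable G 3" for F
    using that unfolding colorable_def delete_edges_def by (metis DiffD1 graph.sel)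
  have del: "edge_stability (delete_edges G {e}) < 2 \<longleftrightarrow> (\<exists>f\<in>?E. two_colorable (?E - {e, f}))"
    if "colorable G 3" "\<not> two_colorable (?E - {e})" for e
  proof -
    have s: "simple_graph (delete_edges G {e})" using simple_delete[OF simple] .
    have "chromatic_number (delete_edges G {e}) = 3"
      using chi[OF s] col_sub that by simp
    then have "edge_stability (delete_edges G {e}) \<le> 1 \<longleftrightarrow> (\<exists>f\<in>?E - {e}. two_colorable (?E - {e} - {f}))"
      using le1[OF s] by simp
    also have "\<dots> \<longleftrightarrow> (\<exists>f\<in>?E. two_colorable (?E - {e, f}))"
    proof -
      have "?E - {e} - {f} = ?E - {e, f}" for f by auto
      moreover have "f \<noteq> e" if f: "two_colorable (?E - {e, f})" for f
      proof
        assume "f = e"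
        then have "?E - {e, f} = ?E - {e}" by simp
        then show False using f \<open>\<not> two_colorable (?E - {e})\<close> by simp
      qed
      ultimately show ?thesis by (metis (no_types, lifting) Diff_iff singletonD)
    qed
    finally show ?thesis by auto
  qed
  show ?thesis
  proof
    assume L: ?L
    then have c3: "chromatic_number G = 3" and es: "edge_stability G = 2" 
      and cr: "\<And>e. e \<in> ?E \<Longrightarrow> edge_stability (delete_edges G {e}) < 2"
      unfolding critical_3_2_def by auto
    have "?E \<noteq> {}" using c3 chi[OF simple] by (auto simp: two_colorable_def)
    moreover have "\<not> two_colorable (?E - {e})" if "e \<in> ?E" for e
      using le1[OF simple c3] es that by auto
    ultimately show ?R using c3 chi[OF simple] del cr by auto
  next
    assume R: ?R
    then obtain e f where ef: "e \<in> ?E" "f \<in> ?E" "two_colorable (?E - {e, f})" by blast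
    have "\<not> two_colorable ?E" using R ef(1) two_colorable_subset[of ?E "?E - {e}"] by blast
    then have c3: "chromatic_number G = 3" using R chi[OF simple] by simp
    have "edge_stability G \<le> 2"
      unfolding edge_stability_le_iff[OF simple c3] using ef
      by (intro exI[of _ "{e, f}"]) (auto simp: card_insert_if)
    moreover have "\<not> edge_stability G \<le> 1" using le1[OF simple c3] R by auto
    ultimately have "edge_stability G = 2" by simp
    then show ?L unfolding critical_3_2_def using c3 R del by auto
  qed
qed

section \<open>Odd cycles as edge sets\<close>

lemma cycle_edges_image: "cycle_edges f m = (\<lambda>e. f ` e) ` edges (cycle_graph m)"
proof -
  have "edges (cycle_graph m) = (\<lambda>j. {j, Suc j mod m}) ` {..<m}" unfolding cycle_graph_def by auto
  then show ?thesis unfolding cycle_edges_def by (simp add: image_image)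
qed

lemma Union_cycle_edges:
  assumes "m \<ge> 1" shows "\<Union>(cycle_edges \<gamma> m) = \<gamma> ` {..<m}"
proof -
  have "Suc j mod m < m" for j using assms by simp
  then show ?thesis unfolding cycle_edges_def by blast
qed

lemma card_odd_cycles: 
  fixes G :: "'a graph"
  assumes "simple_graph G"
  shows "card (odd_cycles G) = card {F. F \<subseteq> edges G \<and> is_cycle F \<and> odd (card F)}"
proof -
  have cyc: "isomorphic (cycle_graph m) H \<longleftrightarrow>
      (\<exists>f. inj_on f {..<m} \<and> edges H = cycle_edges f m \<and> verts H = \<Union>(edges H))" 
    if "m \<ge> 3" for m and H :: "'a graph"
  proof -
    have "bij_betw f (verts (cycle_graph m)) (verts H) \<and> edges H = (\<lambda>e. f ` e) ` edges (cycle_graph m)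
      \<longleftrightarrow> inj_on f {..<m} \<and> edges H = cycle_edges f m \<and> verts H = \<Union>(edges H)" for f
    proof -
      have vs: "verts (cycle_graph m) = {..<m}" by (simp add: cycle_graph_def)
      have un: "\<Union>(cycle_edges f m) = f ` {..<m}" using Union_cycle_edges[of m f] that by simp
      have taut: "(A \<and> B) \<and> C \<longleftrightarrow> A \<and> C \<and> D" if "C \<Longrightarrow> B \<longleftrightarrow> D" for A B C D
        using that by blast
      show ?thesis unfolding bij_betw_def cycle_edges_image[symmetric] vs
        by (rule taut) (simp only: un, rule eq_commute)
    qed
    then show ?thesis unfolding isomorphic_def by (rule arg_cong[where f = Ex, OF ext])
  qed
  have char: "H \<in> odd_cycles G \<longleftrightarrow> edges H \<subseteq> edges G \<and> is_cycle (edges H) \<and> odd (card (edges H)) \<and>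
      verts H = \<Union>(edges H)" for H
  proof -
    have "edges H \<subseteq> edges G \<Longrightarrow> \<Union>(edges H) \<subseteq> verts G"
      using assms unfolding simple_graph_def by blast
    then show ?thesis
      unfolding odd_cycles_def subgraph_def is_cycle_def mem_Collect_eq using cyc by metis
  qed
  have "inj_on edges (odd_cycles G)"
    by (rule inj_onI) (metis char graph.expand)
  moreover have "edges ` odd_cycles G = {F. F \<subseteq> edges G \<and> is_cycle F \<and> odd (card F)}"
  proof -
    have "F \<in> edges ` odd_cycles G" if "F \<subseteq> edges G" "is_cycle F" "odd (card F)" for F
    proof (rule image_eqI)
      show "F = edges (Graph (\<Union>F) F)" by simp
      show "Graph (\<Union>F) F \<in> odd_cycles G" unfolding char using that by simp
    qed
    moreover have "edges H \<in> {F. F \<subseteq> edges G \<and> is_cycle F \<and> odd (card F)}" if "H \<in> odd_cycles G" for H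
      using that unfolding char by simp
    ultimately show ?thesis by (intro subset_antisym subsetI) auto
  qed
  ultimately show ?thesis by (metis card_image)
qed

section \<open>Partner edges\<close>

locale critical_edges =
  fixes E :: "'a set set"
  assumes finite_E: "finite E"
    and card_edge: "\<And>e. e \<in> E \<Longrightarrow> card e = 2"
    and nonempty: "E \<noteq> {}"
    and stable: "\<And>e. e \<in> E \<Longrightarrow> \<not> two_colorable (E - {e})"
    and has_partner: "\<And>e. e \<in> E \<Longrightarrow> \<exists>f\<in>E. two_colorable (E - {e, f})"
begin

definition partner :: "'a set \<Rightarrow> 'a set \<Rightarrow> bool" where
  "partner e f \<longleftrightarrow> e \<in> E \<and> f \<in> E \<and> two_colorable (E - {e, f})"

text \<open>Together, the next two families form the cycle space over the field with two elements.\<close>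

definition even_sets :: "'a set set set" where
  "even_sets = {Z. Z \<subseteq> E \<and> even_degrees Z \<and> even (card Z)}"

definition odd_sets :: "'a set set set" where
  "odd_sets = {Z. Z \<subseteq> E \<and> even_degrees Z \<and> odd (card Z)}"

lemma partner_sym: "partner e f \<Longrightarrow> partner f e"
  unfolding partner_def by (simp add: insert_commute)

lemma partnerE:
  assumes "e \<in> E" obtains f where "partner e f"
  using has_partner[OF assms] assms unfolding partner_def by blast

text \<open>In a two-colouring of the graph without two partners, both of them have ends of equal
  colour; by \<open>even_bichromatic\<close> the parity of an even-degree set is then the number of partners
  in it.\<close>

lemma odd_iff_one_partner:
  assumes p: "partner e f" and Z: "Z \<subseteq> E" "even_degrees Z"
  shows "odd (card Z) \<longleftrightarrow> (e \<in> Z) \<noteq> (f \<in> Z)"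
proof -
  have ef: "e \<in> E" "f \<in> E" using p unfolding partner_def by auto
  obtain c :: "'a \<Rightarrow> bool" where c: "\<And>u v. {u, v} \<in> E - {e, f} \<Longrightarrow> c u \<noteq> c v"
    using p unfolding partner_def two_colorable_def by blast
  have ne: "e \<noteq> f" using stable[OF ef(1)] p unfolding partner_def by auto
  have finZ: "finite Z" using finite_E Z(1) finite_subset by blast
  have bad: "c u = c v" if "{u, v} = x" "x \<in> {e, f}" for u v x
  proof (rule ccontr)
    assume n: "c u \<noteq> c v"
    obtain y where y: "y \<in> E" "{e, f} = {x, y}"
    proof (cases "x = e")
      case True
      then show thesis using that[of f] ef by simp
    next
      case False
      then have "x = f" using \<open>x \<in> {e, f}\<close> by simp
      then show thesis using that[of e] ef by (simp add: insert_commute)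
    qed
    have "two_colorable (E - {y})"
      unfolding two_colorable_def
    proof (intro exI[of _ c] allI impI)
      fix a b assume "{a, b} \<in> E - {y}"
      then have ab: "{a, b} \<in> E" "{a, b} \<noteq> y" by auto
      show "c a \<noteq> c b"
      proof (cases "{a, b} = x")
        case True
        then have "(a = u \<and> b = v) \<or> (a = v \<and> b = u)"
          using \<open>{u, v} = x\<close> by (metis doubleton_eq_iff)
        then show ?thesis using n by auto
      next
        case False
        then show ?thesis using c[of a b] y(2) ab by simp
      qed
    qed
    then show False using stable y(1) by blast
  qed
  have bi: "(\<exists>u\<in>x. \<exists>v\<in>x. c u \<noteq> c v) \<longleftrightarrow> x \<notin> {e, f}" if "x \<in> Z" for x
  proof -
    obtain a b where "x = {a, b}" "a \<noteq> b" using card_edge \<open>x \<in> Z\<close> Z(1) by (metis card_2_iff subsetD)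
    then show ?thesis using bad[of a b x] c[of a b] that Z(1) by auto
  qed
  have "{x \<in> Z. \<exists>u\<in>x. \<exists>v\<in>x. c u \<noteq> c v} = Z - {e, f}" using bi by blast
  then have "even (card (Z - {e, f}))"
    using even_bichromatic[OF finZ _ Z(2), of c] card_edge Z(1) by (metis subsetD)
  moreover have "card Z = card (Z - {e, f}) + card (Z \<inter> {e, f})"
    using finZ by (metis Int_Diff_disjoint Int_commute Un_Diff_Int card_Un_disjoint finite_Diff finite_Int)
  moreover have "odd (card (Z \<inter> {e, f})) \<longleftrightarrow> (e \<in> Z) \<noteq> (f \<in> Z)"
    using ne by (auto simp: Int_insert_right)
  ultimately show ?thesis by simp
qed

lemma even_set_partner: "Z \<in> even_sets \<Longrightarrow> partner e f \<Longrightarrow> e \<in> Z \<longleftrightarrow> f \<in> Z"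
  using odd_iff_one_partner[of e f Z] unfolding even_sets_def by auto

lemma odd_set_partner: "Z \<in> odd_sets \<Longrightarrow> partner e f \<Longrightarrow> e \<in> Z \<longleftrightarrow> f \<notin> Z"
  using odd_iff_one_partner[of e f Z] unfolding odd_sets_def by auto

lemma subset_finite: "Z \<subseteq> E \<Longrightarrow> finite Z"
  using finite_E finite_subset by blast

lemma finite_odd_sets: "finite odd_sets"
  unfolding odd_sets_def using finite_E by simp

lemma sym_diff_sets:
  assumes "A \<subseteq> E" "even_degrees A" "B \<subseteq> E" "even_degrees B"
  shows "sym_diff A B \<in> (if even (card A) \<longleftrightarrow> even (card B) then even_sets else odd_sets)"
  using assms even_degrees_sym_diff[OF subset_finite subset_finite, of A B]
    even_card_sym_diff[OF subset_finite subset_finite, of A B]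
  unfolding even_sets_def odd_sets_def by auto

lemma odd_odd_sym_diff: "A \<in> odd_sets \<Longrightarrow> B \<in> odd_sets \<Longrightarrow> sym_diff A B \<in> even_sets"
  using sym_diff_sets[of A B] unfolding odd_sets_def by auto

lemma odd_even_sym_diff: "A \<in> odd_sets \<Longrightarrow> B \<in> even_sets \<Longrightarrow> sym_diff A B \<in> odd_sets"
  using sym_diff_sets[of A B] unfolding odd_sets_def even_sets_def by auto

lemma even_even_sym_diff: "A \<in> even_sets \<Longrightarrow> B \<in> even_sets \<Longrightarrow> sym_diff A B \<in> even_sets"
  using sym_diff_sets[of A B] unfolding odd_sets_def even_sets_def by auto

text \<open>An odd set contains an odd cycle, and both contain exactly one of any two partners.\<close>

lemma odd_set_is_cycle:
  assumes "D \<in> odd_sets" shows "is_cycle D"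
proof -
  have D: "D \<subseteq> E" "even_degrees D" "odd (card D)" using assms unfolding odd_sets_def by auto
  obtain Z where Z: "is_cycle Z" "odd (card Z)" "Z \<subseteq> D"
    using odd_even_degrees_contains_odd_cycle[OF subset_finite[OF D(1)] _ D(2,3)] card_edge D(1) by blast
  have Zo: "Z \<in> odd_sets" unfolding odd_sets_def using Z D(1) cycle_even_degrees by auto
  have "x \<in> Z" if "x \<in> D" for x
  proof -
    obtain f where f: "partner x f" using partnerE \<open>x \<in> D\<close> D(1) by blast
    then have "f \<notin> Z" using odd_set_partner[OF assms f] that Z(3) by auto
    then show ?thesis using odd_set_partner[OF Zo f] by blast
  qed
  then have "D = Z" using Z(3) by blast
  then show ?thesis using Z(1) by simp
qed

lemma odd_sets_eq_odd_cycles: "odd_sets = {F. F \<subseteq> E \<and> is_cycle F \<and> odd (card F)}"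
  using odd_set_is_cycle cycle_even_degrees unfolding odd_sets_def by auto

lemma odd_set_avoiding:
  assumes "e \<in> E" obtains D where "D \<in> odd_sets" "e \<notin> D"
proof -
  obtain Z where "is_cycle Z" "odd (card Z)" "Z \<subseteq> E - {e}"
    using not_two_colorable_contains_odd_cycle[OF _ _ stable[OF assms]] finite_E card_edge by blast
  then show thesis using that[of Z] unfolding odd_sets_eq_odd_cycles by blast
qed

lemma odd_set_through:
  assumes "e \<in> E" obtains D where "D \<in> odd_sets" "e \<in> D"
proof -
  obtain f where f: "partner e f" using partnerE[OF assms] .
  then have "f \<in> E" unfolding partner_def by simp
  then obtain D where D: "D \<in> odd_sets" "f \<notin> D" using odd_set_avoiding by blast
  then show thesis using that odd_set_partner[OF D(1) f] by blast
qed

lemma even_set_through: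
  assumes "e \<in> E" obtains Z where "Z \<in> even_sets" "e \<in> Z"
proof -
  obtain D where "D \<in> odd_sets" "e \<in> D" using odd_set_through[OF assms] .
  moreover obtain D' where "D' \<in> odd_sets" "e \<notin> D'" using odd_set_avoiding[OF assms] .
  ultimately show thesis using that[of "sym_diff D D'"] odd_odd_sym_diff by blast
qed

text \<open>The edges of an odd set outside \<open>C\<close> are the partners of the edges of \<open>C\<close> that it leaves out.\<close>

lemma odd_set_eqI:
  assumes "C \<in> odd_sets" "D \<in> odd_sets" "D' \<in> odd_sets" "D \<inter> C = D' \<inter> C"
  shows "D = D'"
proof -
  have "x \<in> D \<longleftrightarrow> x \<in> D'" if "x \<in> E" for x
  proof -
    obtain f where f: "partner x f" using partnerE[OF \<open>x \<in> E\<close>] .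
    have "x \<in> C \<longleftrightarrow> f \<notin> C" "x \<in> D \<longleftrightarrow> f \<notin> D" "x \<in> D' \<longleftrightarrow> f \<notin> D'"
      using assms(1-3) odd_set_partner f by blast+
    then show ?thesis using assms(4) by blast
  qed
  moreover have "D \<subseteq> E" "D' \<subseteq> E" using assms unfolding odd_sets_def by auto
  ultimately show ?thesis by blast
qed

text \<open>An edge outside \<open>C\<close> has its partner in \<open>C\<close>, hence outside \<open>D\<close>, and so lies in \<open>D\<close> itself.\<close>

lemma disjoint_odd_sets:
  assumes "C \<in> odd_sets" "D \<in> odd_sets" "C \<inter> D = {}"
  shows "even_degrees E" "D = E - C"
proof -
  have sub: "C \<subseteq> E" "D \<subseteq> E" using assms unfolding odd_sets_def by auto
  have "x \<in> D" if "x \<in> E" "x \<notin> C" for x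
  proof -
    obtain f where f: "partner x f" using partnerE[OF \<open>x \<in> E\<close>] .
    have "f \<in> C" using odd_set_partner[OF assms(1) f] that(2) by blast
    then show ?thesis using odd_set_partner[OF assms(2) f] assms(3) by blast
  qed
  then show D: "D = E - C" using sub assms(3) by blast
  then have "E = sym_diff C D" using sub by auto
  then show "even_degrees E"
    using odd_odd_sym_diff[OF assms(1,2)] unfolding even_sets_def by auto
qed

lemma even_degrees_meets_odd_set:
  assumes "\<not> even_degrees E" "C \<in> odd_sets" "Z \<subseteq> E" "even_degrees Z" "Z \<noteq> {}"
  shows "Z \<inter> C \<noteq> {}"
proof (cases "odd (card Z)")
  case True
  then have "Z \<in> odd_sets" using assms unfolding odd_sets_def by auto
  then show ?thesis using disjoint_odd_sets(1)[OF assms(2), of Z] assms(1) by blast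
next
  case False
  then have Z: "Z \<in> even_sets" using assms unfolding even_sets_def by auto
  obtain x where x: "x \<in> Z" using assms(5) by auto
  then obtain f where f: "partner x f" using partnerE assms(3) by blast
  show ?thesis
    using even_set_partner[OF Z f] odd_set_partner[OF assms(2) f] x by blast
qed

end


section \<open>A vertex of odd degree leaves at most four odd cycles\<close>

context critical_edges
begin

text \<open>Adding an even set through \<open>e\<close> exchanges the odd sets through \<open>e\<close> with the others.\<close>

lemma odd_sets_through_half:
  assumes "e \<in> E"
  shows "2 * card {D \<in> odd_sets. e \<in> D} = card odd_sets"
proof -
  obtain Z where Z: "Z \<in> even_sets" "e \<in> Z" using even_set_through[OF assms] .
  have "bij_betw (\<lambda>D. sym_diff D Z) {D \<in> odd_sets. e \<in> D} {D \<in> odd_sets. e \<notin> D}"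
    by (rule bij_betw_byWitness[where f' = "\<lambda>D. sym_diff D Z"])
      (use Z odd_even_sym_diff in auto)
  then have "card {D \<in> odd_sets. e \<in> D} = card {D \<in> odd_sets. e \<notin> D}" by (rule bij_betw_same_card)
  moreover have "odd_sets = {D \<in> odd_sets. e \<in> D} \<union> {D \<in> odd_sets. e \<notin> D}" by auto
  then have "card odd_sets = card {D \<in> odd_sets. e \<in> D} + card {D \<in> odd_sets. e \<notin> D}"
    using finite_odd_sets by (subst card_Un_disjoint[symmetric]) auto
  ultimately show ?thesis by simp
qed

text \<open>Every edge lies in half of the odd cycles, so the mean degree of \<open>u\<close> in an odd cycle is half
  its degree; if all odd cycles passed through \<open>u\<close>, that mean would be two and the degree four.\<close>

lemma odd_set_avoiding_vertex:
  assumes "odd (deg E u)"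
  obtains D where "D \<in> odd_sets" "u \<notin> \<Union>D"
proof (rule ccontr)
  assume "\<not> thesis"
  then have all: "\<And>D. D \<in> odd_sets \<Longrightarrow> u \<in> \<Union>D" using that by blast
  let ?T = "{e \<in> E. u \<in> e}"
  have finT: "finite ?T" using finite_E by simp
  have "card {e \<in> ?T. e \<in> D} = 2" if "D \<in> odd_sets" for D
  proof -
    have "{e \<in> ?T. e \<in> D} = {e \<in> D. u \<in> e}" using that unfolding odd_sets_def by auto
    then show ?thesis using cycle_deg[OF odd_set_is_cycle[OF that], of u] all[OF that] by simp
  qed
  then have "2 * card odd_sets = (\<Sum>D\<in>odd_sets. card {e \<in> ?T. e \<in> D})" by simp
  also have "\<dots> = (\<Sum>e\<in>?T. card {D \<in> odd_sets. e \<in> D})"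
    by (rule sum_multicount_gen) (use finT finite_odd_sets in auto)
  finally have "4 * card odd_sets = (\<Sum>e\<in>?T. 2 * card {D \<in> odd_sets. e \<in> D})"
    by (simp add: sum_distrib_left[symmetric])
  also have "\<dots> = (\<Sum>e\<in>?T. card odd_sets)" by (rule sum.cong) (auto simp: odd_sets_through_half)
  finally have "4 * card odd_sets = deg E u * card odd_sets" by simp
  moreover have "odd_sets \<noteq> {}" using nonempty odd_set_through by blast
  ultimately have "deg E u = 4" using finite_odd_sets by simp
  then show False using assms by simp
qed

lemma deg_ge_3:
  assumes "odd (deg E u)"
  shows "deg E u \<ge> 3"
proof -
  obtain e where e: "e \<in> E" "u \<in> e"
    using odd_card_imp_not_empty[OF assms] by auto
  obtain D where D: "D \<in> odd_sets" "e \<in> D" using odd_set_through[OF e(1)] .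
  then have "deg D u = 2" using cycle_deg[OF odd_set_is_cycle, of D u] e(2) by auto
  moreover have "deg D u \<le> deg E u"
    using D(1) finite_E unfolding odd_sets_def by (intro card_mono) auto
  ultimately have "deg E u \<ge> 2" by simp
  moreover have "deg E u \<noteq> 2" using assms by (metis even_numeral)
  ultimately show ?thesis by simp
qed

text \<open>Three such paths from \<open>u\<close> and the odd cycle \<open>C\<close> will form a subdivision of the complete graph on
  four vertices.\<close>

definition spoke :: "'a set set \<Rightarrow> 'a \<Rightarrow> 'a set \<Rightarrow> (nat \<Rightarrow> 'a) \<Rightarrow> nat \<Rightarrow> bool" where
  "spoke C u a \<delta> t \<longleftrightarrow> inj_on \<delta> {..t} \<and> \<delta> 0 = u \<and> t > 0 \<and> {\<delta> 0, \<delta> 1} = a \<and>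
     path_edges \<delta> t \<subseteq> E - C \<and> \<delta> t \<in> \<Union>C \<and> (\<forall>j<t. \<delta> j \<notin> \<Union>C)"

text \<open>Follow a cycle through the edge; it shares an edge with \<open>C\<close>.\<close>

lemma spoke_exists:
  assumes ne: "\<not> even_degrees E" and C: "C \<in> odd_sets" and u: "u \<notin> \<Union>C" and a: "a \<in> E" "u \<in> a"
  obtains \<delta> t where "spoke C u a \<delta> t"
proof -
  obtain w where w: "a = {w, u}" "w \<noteq> u"
    using card_edge[OF a(1)] a(2) by (metis card_2_iff doubleton_eq_iff insertE singletonD)
  obtain Z where Z: "Z \<in> even_sets" "a \<in> Z" using even_set_through[OF a(1)] .
  then have Z': "Z \<subseteq> E" "even_degrees Z" unfolding even_sets_def by auto
  obtain \<theta> p where th: "inj_on \<theta> {..p}" "\<theta> 0 = w" "\<theta> p = u" "path_edges \<theta> p \<subseteq> Z - {{w, u}}"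
    using even_degrees_path[OF subset_finite[OF Z'(1)] _ Z'(2), of w u] card_edge Z'(1) Z(2) w(1) by blast
  let ?W = "insert {\<theta> p, \<theta> 0} (path_edges \<theta> p)"
  have "is_cycle ?W" by (rule path_closing_edge(2)) (use th w in \<open>auto simp: insert_commute\<close>)
  moreover have "?W \<subseteq> E" using th Z Z' w by (auto simp: insert_commute)
  ultimately obtain g where g: "g \<in> ?W" "g \<in> C"
    using even_degrees_meets_odd_set[OF ne C, of ?W] cycle_even_degrees by auto
  have "g \<noteq> {\<theta> p, \<theta> 0}" using g(2) u th(3) by auto
  then have "g \<in> path_edges \<theta> p" using g(1) by simp
  then obtain i where "i < p" "g = {\<theta> i, \<theta> (Suc i)}" unfolding path_edges_def by auto
  then have i: "i < p" "\<theta> i \<in> \<Union>C" using g(2) by auto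
  define t where "t = (LEAST i. \<theta> i \<in> \<Union>C)"
  have t: "\<theta> t \<in> \<Union>C" unfolding t_def using i(2) by (rule LeastI)
  have tp: "t < p" using i unfolding t_def by (meson Least_le order_le_less_trans)
  have before: "\<theta> j \<notin> \<Union>C" if "j < t" for j using that not_less_Least unfolding t_def by blast
  define \<delta> where "\<delta> = (\<lambda>j. case j of 0 \<Rightarrow> u | Suc i \<Rightarrow> \<theta> i)"
  have d [simp]: "\<delta> 0 = u" "\<delta> (Suc j) = \<theta> j" for j by (auto simp: \<delta>_def)
  have inj: "\<theta> x = \<theta> y \<longleftrightarrow> x = y" if "x \<le> p" "y \<le> p" for x y
    using th(1) that by (meson atMost_iff inj_onD)
  have "spoke C u a \<delta> (Suc t)"
    unfolding spoke_def
  proof (intro conjI allI impI)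
    show "inj_on \<delta> {..Suc t}"
    proof (rule inj_onI)
      fix x y assume "x \<in> {..Suc t}" "y \<in> {..Suc t}" "\<delta> x = \<delta> y"
      then show "x = y" using inj tp th(3) by (cases x; cases y) auto
    qed
    show "path_edges \<delta> (Suc t) \<subseteq> E - C"
    proof
      fix e assume "e \<in> path_edges \<delta> (Suc t)"
      then obtain j where j: "j < Suc t" "e = {\<delta> j, \<delta> (Suc j)}" unfolding path_edges_def by auto
      show "e \<in> E - C"
      proof (cases j)
        case 0
        then have "e = a" using j(2) w th(2) by (auto simp: insert_commute)
        then show ?thesis using a u by auto
      next
        case (Suc i)
        then have e: "e = {\<theta> i, \<theta> (Suc i)}" "i < t" using j by auto
        then have "e \<in> path_edges \<theta> p" using tp unfolding path_edges_def by auto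
        then have "e \<in> E" using th(4) Z' by auto
        then show ?thesis using before[OF e(2)] e(1) by auto
      qed
    qed
    show "\<delta> j \<notin> \<Union>C" if "j < Suc t" for j using that before u by (cases j) auto
  qed (use t th w in \<open>auto simp: insert_commute\<close>)
  then show thesis by (rule that)
qed

lemma spoke_first_edge:
  assumes "spoke C u a \<delta> t" "e \<in> path_edges \<delta> t" "u \<in> e"
  shows "e = a"
proof -
  have s: "inj_on \<delta> {..t}" "\<delta> 0 = u" "{\<delta> 0, \<delta> 1} = a" using assms(1) unfolding spoke_def by auto
  obtain j where j: "j < t" "e = {\<delta> j, \<delta> (Suc j)}" using assms(2) unfolding path_edges_def by auto
  then have "\<delta> 0 = \<delta> j \<or> \<delta> 0 = \<delta> (Suc j)" using assms(3) s(2) by auto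
  then have "j = 0" using s(1) j(1) by (auto dest: inj_onD)
  then show ?thesis using j s by simp
qed

lemma first_edge_in_spoke:
  assumes "spoke C u a \<delta> t" "0 < i"
  shows "a \<in> path_edges \<delta> i"
  using assms unfolding spoke_def path_edges_def by auto

text \<open>A second common vertex would give a nonempty even-degree set outside \<open>C\<close>.\<close>

lemma spokes_disjoint:
  assumes ne: "\<not> even_degrees E" and C: "C \<in> odd_sets"
    and s: "spoke C u a \<delta> s" "spoke C u b \<eta> t" "a \<noteq> b"
    and ij: "\<delta> i = \<eta> j" "i \<le> s" "j \<le> t"
  shows "i = 0"
proof (rule ccontr)
  assume "i \<noteq> 0"
  have D: "inj_on \<delta> {..i}" "inj_on \<eta> {..j}" "\<delta> 0 = u" "\<eta> 0 = u" 
    using s ij unfolding spoke_def by (meson atMost_subset_iff inj_on_subset)+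
  have i0: "0 < i" using \<open>i \<noteq> 0\<close> by simp
  have "\<delta> i \<noteq> \<delta> 0" using D(1) \<open>i \<noteq> 0\<close> by (metis atMost_iff inj_onD le0 order_refl)
  then have j0: "0 < j" using ij D by (cases j) auto
  let ?A = "path_edges \<delta> i" and ?B = "path_edges \<eta> j"
  have sub: "?A \<subseteq> E - C" "?B \<subseteq> E - C"
    using s path_edges_mono[OF ij(2), of \<delta>] path_edges_mono[OF ij(3), of \<eta>] unfolding spoke_def by blast+
  have "even_degrees (sym_diff ?A ?B)"
    using deg_path_edges[OF D(1)] deg_path_edges[OF D(2)] D ij i0 j0
    by (intro even_degrees_sym_diffI) simp_all
  then have "sym_diff ?A ?B = {}"
    using even_degrees_meets_odd_set[OF ne C, of "sym_diff ?A ?B"] sub by blast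
  moreover have "a \<in> ?A" using first_edge_in_spoke[OF s(1) i0] .
  moreover have "a \<notin> ?B"
  proof
    assume "a \<in> ?B"
    then have "a \<in> path_edges \<eta> t" using path_edges_mono[OF ij(3), of \<eta>] by blast
    moreover have "u \<in> a" using s(1) unfolding spoke_def by auto
    ultimately show False using spoke_first_edge[OF s(2)] s(3) by blast
  qed
  ultimately show False by blast
qed

lemma spokes_edge_disjoint:
  assumes "\<not> even_degrees E" "C \<in> odd_sets" "spoke C u a \<delta> s" "spoke C u b \<eta> t" "a \<noteq> b"
  shows "path_edges \<delta> s \<inter> path_edges \<eta> t = {}"
proof (rule ccontr)
  assume "path_edges \<delta> s \<inter> path_edges \<eta> t \<noteq> {}"
  then obtain i j where ij: "i < s" "j < t" "{\<delta> i, \<delta> (Suc i)} = {\<eta> j, \<eta> (Suc j)}"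
    unfolding path_edges_def by auto
  then have "\<delta> (Suc i) = \<eta> j \<or> \<delta> (Suc i) = \<eta> (Suc j)" by (auto simp: doubleton_eq_iff)
  then show False using spokes_disjoint[OF assms, of "Suc i"] ij by fastforce
qed

text \<open>The lengths of the two arcs of \<open>C\<close> between \<open>p\<close> and \<open>q\<close> add up to the odd length of \<open>C\<close>, so one of
  them has the parity of \<open>P\<close>.\<close>

lemma arc_of_same_parity:
  assumes C: "C \<in> odd_sets" and pq: "p \<in> \<Union>C" "q \<in> \<Union>C" "p \<noteq> q"
    and P: "P \<subseteq> E - C" "\<And>v. odd (deg P v) \<longleftrightarrow> v = p \<or> v = q"
  obtains \<rho> n where "inj_on \<rho> {..n}" "\<rho> 0 = p" "\<rho> n = q" "0 < n" "path_edges \<rho> n \<subseteq> C"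
    "P \<union> path_edges \<rho> n \<in> even_sets"
proof -
  have CE: "C \<subseteq> E" "odd (card C)" using C unfolding odd_sets_def by auto
  obtain \<delta> l \<delta>' l' where arcs: "inj_on \<delta> {..l}" "\<delta> 0 = p" "\<delta> l = q"
    "inj_on \<delta>' {..l'}" "\<delta>' 0 = p" "\<delta>' l' = q" "l > 0" "l' > 0"
    "path_edges \<delta> l \<inter> path_edges \<delta>' l' = {}" "path_edges \<delta> l \<union> path_edges \<delta>' l' = C"
    using cycle_arcs[OF odd_set_is_cycle[OF C] pq] by metis
  have finP: "finite P" using P(1) finite_E by (meson Diff_subset finite_subset)
  have even: "P \<union> path_edges \<rho> n \<in> even_sets"
    if r: "inj_on \<rho> {..n}" "\<rho> 0 = p" "\<rho> n = q" "0 < n" "path_edges \<rho> n \<subseteq> C"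
      "even (card P + card (path_edges \<rho> n))" for \<rho> n
  proof -
    let ?R = "path_edges \<rho> n"
    have sd: "P \<union> ?R = sym_diff P ?R" using P(1) r(5) by auto
    have "even_degrees (sym_diff P ?R)"
      using finP deg_path_edges[OF r(1)] P(2) r(2-4) by (intro even_degrees_sym_diffI) simp_all
    moreover have "even (card (sym_diff P ?R))" using even_card_sym_diff[OF finP, of ?R] r(6) by simp
    ultimately show ?thesis unfolding even_sets_def sd[symmetric] using P(1) r(5) CE by auto
  qed
  have "card C = card (path_edges \<delta> l) + card (path_edges \<delta>' l')"
    using arcs(9,10) card_Un_disjoint[of "path_edges \<delta> l" "path_edges \<delta>' l'"] by simp
  then have "even (card P + card (path_edges \<delta> l)) \<or> even (card P + card (path_edges \<delta>' l'))"
    using CE(2) by auto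
  then show thesis
    using that[of \<delta> l] that[of \<delta>' l'] even[of \<delta> l] even[of \<delta>' l'] arcs by blast
qed

lemma even_deg_two_edges:
  assumes "even_degrees Z" "{e \<in> Z. v \<in> e} \<subseteq> {x, y}" "v \<in> x" "v \<in> y" "x \<noteq> y"
  shows "x \<in> Z \<longleftrightarrow> y \<in> Z"
proof (rule ccontr)
  assume "(x \<in> Z) \<noteq> (y \<in> Z)"
  then have "{e \<in> Z. v \<in> e} = {x} \<or> {e \<in> Z. v \<in> e} = {y}" using assms(2-4) by auto
  then have "deg Z v = 1" by (metis is_singletonI is_singleton_altdef)
  then show False using assms(1) unfolding even_degrees_def by (metis odd_one)
qed

text \<open>At every other vertex of the cycle, each of \<open>R1\<close> and \<open>R2\<close> contains both edges or none. Along the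
  cycle, membership in them thus changes at three vertices at most, so that at most three of its
  four combinations occur.\<close>

lemma two_arcs_cover:
  assumes cyc: "is_cycle C" and V: "p \<in> \<Union>C" "q \<in> \<Union>C" "s \<in> \<Union>C"
    and R: "R1 \<subseteq> C" "R2 \<subseteq> C"
      "\<And>v. odd (deg R1 v) \<Longrightarrow> v \<in> {p, q, s}" "\<And>v. odd (deg R2 v) \<Longrightarrow> v \<in> {p, q, s}"
    and ne: "R1 \<inter> R2 \<noteq> {}" "R1 - R2 \<noteq> {}" "R2 - R1 \<noteq> {}"
  shows "C = R1 \<union> R2"
proof (rule ccontr)
  assume "C \<noteq> R1 \<union> R2"
  then obtain x where x: "x \<in> C" "x \<notin> R1" "x \<notin> R2" using R(1,2) by blast
  obtain \<gamma> n where g: "n \<ge> 2" "inj_on \<gamma> {..n}" "C = insert {\<gamma> n, \<gamma> 0} (path_edges \<gamma> n)" "\<gamma> 0 = p"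
    using cycle_startE[OF cyc V(1)] by metis
  have inj: "\<gamma> x = \<gamma> y \<longleftrightarrow> x = y" if "x \<le> n" "y \<le> n" for x y
    using g(2) that by (meson atMost_iff inj_onD)
  have "\<Union>C \<subseteq> \<gamma> ` {..n}" using g(3) Union_path_edges[of \<gamma> n] by auto
  then obtain b c where bc: "b \<le> n" "c \<le> n" "q = \<gamma> b" "s = \<gamma> c" using V by blast
  define \<epsilon> where "\<epsilon> j = (if j < n then {\<gamma> j, \<gamma> (Suc j)} else {\<gamma> n, \<gamma> 0})" for j
  have C_eq: "C = \<epsilon> ` {..n}"
  proof -
    have "{..n} = insert n {..<n}" by auto
    then have "\<epsilon> ` {..n} = insert (\<epsilon> n) (\<epsilon> ` {..<n})" by (metis image_insert)
    also have "\<epsilon> n = {\<gamma> n, \<gamma> 0}" by (simp add: \<epsilon>_def)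
    also have "\<epsilon> ` {..<n} = path_edges \<gamma> n"
      unfolding path_edges_def by (rule image_cong) (auto simp: \<epsilon>_def)
    finally show ?thesis using g(3) by simp
  qed
  have step: "\<epsilon> (j - 1) \<in> R \<longleftrightarrow> \<epsilon> j \<in> R"
    if j: "0 < j" "j \<le> n" "\<gamma> j \<notin> {p, q, s}" and RC: "R \<subseteq> C" "\<And>v. odd (deg R v) \<Longrightarrow> v \<in> {p, q, s}" for j R
  proof (rule ccontr)
    assume differ: "(\<epsilon> (j - 1) \<in> R) \<noteq> (\<epsilon> j \<in> R)"
    have "{e \<in> C. \<gamma> j \<in> e} \<subseteq> {\<epsilon> (j - 1), \<epsilon> j}"
    proof
      fix e assume "e \<in> {e \<in> C. \<gamma> j \<in> e}"
      then obtain i where i: "i \<le> n" "e = \<epsilon> i" "\<gamma> j \<in> \<epsilon> i" unfolding C_eq by auto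
      then have "i = j \<or> Suc i = j" using inj j(1,2) by (auto simp: \<epsilon>_def split: if_splits)
      then show "e \<in> {\<epsilon> (j - 1), \<epsilon> j}" using i by auto
    qed
    moreover have "\<gamma> j \<in> \<epsilon> (j - 1)" "\<gamma> j \<in> \<epsilon> j" using j(1,2) by (auto simp: \<epsilon>_def)
    ultimately have "{e \<in> R. \<gamma> j \<in> e} = {\<epsilon> (j - 1)} \<or> {e \<in> R. \<gamma> j \<in> e} = {\<epsilon> j}"
      using RC(1) differ by blast
    then have "deg R (\<gamma> j) = 1" by (metis is_singletonI is_singleton_altdef)
    then show False using RC(2)[of "\<gamma> j"] j(3) by (metis odd_one)
  qed
  define f where "f j = (\<epsilon> j \<in> R1, \<epsilon> j \<in> R2)" for j
  have "f j \<in> {f 0, f b, f c}" if "j \<le> n" for j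
    using that
  proof (induction j)
    case (Suc j)
    show ?case
    proof (cases "\<gamma> (Suc j) \<in> {p, q, s}")
      case True
      then have "Suc j = 0 \<or> Suc j = b \<or> Suc j = c" using inj Suc.prems bc g(4) by auto
      then show ?thesis by auto
    next
      case False
      then have "f (Suc j) = f j"
        using step[of "Suc j" R1] step[of "Suc j" R2] R Suc.prems unfolding f_def by auto
      then show ?thesis using Suc by auto
    qed
  qed simp
  then have "f ` {..n} \<subseteq> {f 0, f b, f c}" by (intro image_subsetI) simp
  then have "card (f ` {..n}) \<le> card {f 0, f b, f c}" by (intro card_mono) auto
  also have "\<dots> \<le> 3" by (simp add: card_insert_if)
  finally have le3: "card (f ` {..n}) \<le> 3" .
  have "{(True, True), (True, False), (False, True), (False, False)} \<subseteq> f ` {..n}"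
  proof -
    have mem: "(e \<in> R1, e \<in> R2) \<in> f ` {..n}" if "e \<in> C" for e
      using that unfolding C_eq f_def by auto
    obtain y z w where "y \<in> R1 \<inter> R2" "z \<in> R1 - R2" "w \<in> R2 - R1" using ne by blast
    then show ?thesis using mem[of x] mem[of y] mem[of z] mem[of w] x R(1,2) by auto
  qed
  then have "card {(True, True), (True, False), (False, True), (False, False)} \<le> card (f ` {..n})"
    by (intro card_mono) auto
  then show False using le3 by simp
qed

text \<open>At a vertex of degree two, an even-degree set contains both edges or none.\<close>

lemma even_set_avoids_spoke:
  assumes s: "spoke C u a \<delta> t" and Z: "Z \<subseteq> E" "even_degrees Z" "a \<notin> Z"
    and deg2: "\<And>j. 0 < j \<Longrightarrow> j < t \<Longrightarrow> {e \<in> E. \<delta> j \<in> e} \<subseteq> path_edges \<delta> t"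
  shows "Z \<inter> path_edges \<delta> t = {}"
proof -
  have inj: "inj_on \<delta> {..t}" and a: "{\<delta> 0, \<delta> 1} = a" using s unfolding spoke_def by auto
  have "{\<delta> j, \<delta> (Suc j)} \<notin> Z" if "j < t" for j
    using that
  proof (induction j)
    case 0
    then show ?case using a Z(3) by simp
  next
    case (Suc j)
    note at = path_edges_at_interior[OF inj, of "Suc j"]
    have "{e \<in> Z. \<delta> (Suc j) \<in> e} \<subseteq> {{\<delta> j, \<delta> (Suc j)}, {\<delta> (Suc j), \<delta> (Suc (Suc j))}}"
    proof -
      have "{e \<in> E. \<delta> (Suc j) \<in> e} \<subseteq> path_edges \<delta> t" using deg2[of "Suc j"] Suc.prems by simp
      then have "{e \<in> Z. \<delta> (Suc j) \<in> e} \<subseteq> {e \<in> path_edges \<delta> t. \<delta> (Suc j) \<in> e}" using Z(1) by blast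
      then show ?thesis using at(1) Suc.prems by simp
    qed
    moreover have "{\<delta> j, \<delta> (Suc j)} \<notin> Z" using Suc by simp
    moreover have "{\<delta> j, \<delta> (Suc j)} \<noteq> {\<delta> (Suc j), \<delta> (Suc (Suc j))}" using at(2) Suc.prems by simp
    ultimately show ?case
      using even_deg_two_edges[OF Z(2), of "\<delta> (Suc j)" "{\<delta> j, \<delta> (Suc j)}" "{\<delta> (Suc j), \<delta> (Suc (Suc j))}"]
      by blast
  qed
  then show ?thesis unfolding path_edges_def by auto
qed

text \<open>Three spokes from \<open>u\<close> to an odd cycle \<open>C\<close> that avoids \<open>u\<close>, with suitable arcs of \<open>C\<close>, give even
  sets that cover \<open>C\<close> and hence, being closed under partners, all edges: the graph is a
  subdivision of the complete graph on four vertices. An odd set is then determined by which of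
  two of the edges at \<open>u\<close> it contains.\<close>

lemma card_odd_sets_odd_degree:
  assumes u: "odd (deg E u)"
  shows "card odd_sets \<le> 4"
proof -
  have ne: "\<not> even_degrees E" using u unfolding even_degrees_def by blast
  obtain C where C: "C \<in> odd_sets" "u \<notin> \<Union>C" using odd_set_avoiding_vertex[OF u] .
  have CE: "C \<subseteq> E" using C unfolding odd_sets_def by auto
  obtain T where "T \<subseteq> {e \<in> E. u \<in> e}" "card T = 3"
    using deg_ge_3[OF u] by (meson obtain_subset_with_card_n)
  then obtain a b c where abc: "a \<in> E" "b \<in> E" "c \<in> E" "u \<in> a" "u \<in> b" "u \<in> c" "a \<noteq> b" "b \<noteq> c" "a \<noteq> c"
    by (auto simp: card_3_iff)
  obtain \<delta> k where sa: "spoke C u a \<delta> k" using spoke_exists[OF ne C abc(1,4)] .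
  obtain \<eta> l where sb: "spoke C u b \<eta> l" using spoke_exists[OF ne C abc(2,5)] .
  obtain \<theta> m where sc: "spoke C u c \<theta> m" using spoke_exists[OF ne C abc(3,6)] .
  let ?A = "path_edges \<delta> k" and ?B = "path_edges \<eta> l" and ?C = "path_edges \<theta> m"
  let ?p = "\<delta> k" and ?q = "\<eta> l" and ?s = "\<theta> m"
  have pos: "k > 0" "l > 0" "m > 0" using sa sb sc unfolding spoke_def by auto
  have sub: "?A \<subseteq> E - C" "?B \<subseteq> E - C" "?C \<subseteq> E - C" using sa sb sc unfolding spoke_def by auto
  have ends: "?p \<in> \<Union>C" "?q \<in> \<Union>C" "?s \<in> \<Union>C" using sa sb sc unfolding spoke_def by auto
  have ne_ends: "?p \<noteq> ?q" "?q \<noteq> ?s"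
    using spokes_disjoint[OF ne C(1) sa sb abc(7), of k l] spokes_disjoint[OF ne C(1) sb sc abc(8), of l m] pos
    by auto
  have disj: "?A \<inter> ?B = {}" "?B \<inter> ?C = {}" "?A \<inter> ?C = {}"
    using spokes_edge_disjoint[OF ne C(1)] sa sb sc abc(7-9) by blast+
  have first: "a \<in> ?A" "b \<in> ?B" "c \<in> ?C"
    using first_edge_in_spoke sa sb sc pos by blast+
  have odd_spoke: "odd (deg (path_edges \<zeta> n) v) \<longleftrightarrow> v = u \<or> v = \<zeta> n" if "spoke C u d \<zeta> n" for \<zeta> n d v
    using that deg_path_edges[of \<zeta> n v] unfolding spoke_def by auto
  have uC: "u \<noteq> ?p" "u \<noteq> ?q" "u \<noteq> ?s" using ends C(2) by auto
  have AB: "odd (deg (?A \<union> ?B) v) \<longleftrightarrow> v = ?p \<or> v = ?q" for v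
  proof -
    have "?A \<union> ?B = sym_diff ?A ?B" using disj by auto
    then show ?thesis
      using even_deg_sym_diff[of ?A ?B v] odd_spoke[OF sa] odd_spoke[OF sb] uC ne_ends by auto
  qed
  have BC: "odd (deg (?B \<union> ?C) v) \<longleftrightarrow> v = ?q \<or> v = ?s" for v
  proof -
    have "?B \<union> ?C = sym_diff ?B ?C" using disj by auto
    then show ?thesis
      using even_deg_sym_diff[of ?B ?C v] odd_spoke[OF sb] odd_spoke[OF sc] uC ne_ends by auto
  qed
  obtain \<rho> n where r: "inj_on \<rho> {..n}" "\<rho> 0 = ?p" "\<rho> n = ?q" "0 < n" "path_edges \<rho> n \<subseteq> C"
    "?A \<union> ?B \<union> path_edges \<rho> n \<in> even_sets"
    using arc_of_same_parity[OF C(1) ends(1,2) ne_ends(1) _ AB] sub(1,2) by auto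
  obtain \<rho>' n' where r': "inj_on \<rho>' {..n'}" "\<rho>' 0 = ?q" "\<rho>' n' = ?s" "0 < n'" "path_edges \<rho>' n' \<subseteq> C"
    "?B \<union> ?C \<union> path_edges \<rho>' n' \<in> even_sets"
    using arc_of_same_parity[OF C(1) ends(2,3) ne_ends(2) _ BC] sub(2,3) by auto
  let ?R = "path_edges \<rho> n" and ?R' = "path_edges \<rho>' n'"
  have partners: "f \<in> C \<and> (f \<in> ?R \<longleftrightarrow> x \<in> ?A \<union> ?B) \<and> (f \<in> ?R' \<longleftrightarrow> x \<in> ?B \<union> ?C)"
    if "x \<in> E - C" "partner x f" for x f
  proof -
    have "f \<in> C" using odd_set_partner[OF C(1) that(2)] that(1) by blast
    moreover have "x \<notin> ?R" "x \<notin> ?R'" using that(1) r(5) r'(5) by auto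
    moreover have "f \<notin> ?A" "f \<notin> ?B" "f \<notin> ?C" using calculation(1) sub by auto
    ultimately show ?thesis
      using even_set_partner[OF r(6) that(2)] even_set_partner[OF r'(6) that(2)] by blast
  qed
  have "C = ?R \<union> ?R'"
  proof (rule two_arcs_cover[OF odd_set_is_cycle[OF C(1)] ends r(5) r'(5)])
    show "v \<in> {?p, ?q, ?s}" if "odd (deg ?R v)" for v
      using that deg_path_edges[OF r(1), of v] r by auto
    show "v \<in> {?p, ?q, ?s}" if "odd (deg ?R' v)" for v
      using that deg_path_edges[OF r'(1), of v] r' by auto
    obtain f g h where fgh: "partner a f" "partner b g" "partner c h" using partnerE abc(1-3) by metis
    show "?R \<inter> ?R' \<noteq> {}" using partners[OF _ fgh(2)] first sub by blast
    show "?R - ?R' \<noteq> {}" using partners[OF _ fgh(1)] first sub disj by blast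
    show "?R' - ?R \<noteq> {}" using partners[OF _ fgh(3)] first sub disj by blast
  qed
  have E_eq: "E = C \<union> ?A \<union> ?B \<union> ?C"
  proof -
    have "x \<in> ?A \<union> ?B \<union> ?C" if "x \<in> E - C" for x
    proof -
      obtain f where f: "partner x f" using partnerE \<open>x \<in> E - C\<close> by blast
      show ?thesis using partners[OF that f] \<open>C = ?R \<union> ?R'\<close> by blast
    qed
    then show ?thesis using CE sub by blast
  qed
  have at_u: "{e \<in> E. u \<in> e} \<subseteq> {a, b, c}"
    using E_eq C(2) spoke_first_edge[OF sa] spoke_first_edge[OF sb] spoke_first_edge[OF sc] by blast
  have interior: "{e \<in> E. \<zeta> j \<in> e} \<subseteq> path_edges \<zeta> n"
    if z: "spoke C u d \<zeta> n" "d = a \<and> \<zeta> = \<delta> \<and> n = k \<or> d = b \<and> \<zeta> = \<eta> \<and> n = l \<or> d = c \<and> \<zeta> = \<theta> \<and> n = m"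
      and j: "0 < j" "j < n" for d \<zeta> n j
  proof -
    have off: "\<zeta> j \<notin> \<Union>(path_edges \<xi> n')" if "spoke C u d' \<xi> n'" "d \<noteq> d'" for d' \<xi> n'
    proof
      assume "\<zeta> j \<in> \<Union>(path_edges \<xi> n')"
      then obtain i where "i \<le> n'" "\<zeta> j = \<xi> i" using Union_path_edges[of \<xi> n'] by auto
      then show False using spokes_disjoint[OF ne C(1) z(1) that(1,2), of j i] j by auto
    qed
    have offC: "\<zeta> j \<notin> \<Union>C" using z(1) j unfolding spoke_def by auto
    have offs: "d \<noteq> a \<Longrightarrow> \<zeta> j \<notin> \<Union>?A" "d \<noteq> b \<Longrightarrow> \<zeta> j \<notin> \<Union>?B" "d \<noteq> c \<Longrightarrow> \<zeta> j \<notin> \<Union>?C"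
      using off[OF sa] off[OF sb] off[OF sc] by auto
    have own: "d = a \<Longrightarrow> path_edges \<zeta> n = ?A" "d = b \<Longrightarrow> path_edges \<zeta> n = ?B" "d = c \<Longrightarrow> path_edges \<zeta> n = ?C"
      using z(2) abc(7-9) by auto
    show ?thesis
    proof
      fix e assume "e \<in> {e \<in> E. \<zeta> j \<in> e}"
      then have e: "e \<in> E" "\<zeta> j \<in> e" by auto
      then have "e \<notin> C" using offC by blast
      then consider "e \<in> ?A" | "e \<in> ?B" | "e \<in> ?C" using e(1) E_eq by blast
      then show "e \<in> path_edges \<zeta> n" using e(2) offs own by cases blast+
    qed
  qed
  have "inj_on (\<lambda>D. (a \<in> D, b \<in> D)) odd_sets"
  proof (rule inj_onI)
    fix D D' assume D: "D \<in> odd_sets" "D' \<in> odd_sets" "(a \<in> D, b \<in> D) = (a \<in> D', b \<in> D')"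
    let ?Z = "sym_diff D D'"
    have Z: "?Z \<in> even_sets" using odd_odd_sym_diff D by blast
    then have Z': "?Z \<subseteq> E" "even_degrees ?Z" unfolding even_sets_def by auto
    have ab: "a \<notin> ?Z" "b \<notin> ?Z" using D(3) by auto
    have c: "c \<notin> ?Z"
    proof
      assume "c \<in> ?Z"
      then have "{e \<in> ?Z. u \<in> e} = {c}" using at_u ab Z'(1) abc(6) by blast
      then have "deg ?Z u = 1" by simp
      then show False using Z'(2) unfolding even_degrees_def by (metis odd_one)
    qed
    have off: "?Z \<inter> ?A = {}" "?Z \<inter> ?B = {}" "?Z \<inter> ?C = {}"
      using even_set_avoids_spoke[OF sa Z' ab(1) interior[OF sa]]
        even_set_avoids_spoke[OF sb Z' ab(2) interior[OF sb]]
        even_set_avoids_spoke[OF sc Z' c interior[OF sc]] by auto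
    then have ZC: "?Z \<subseteq> C" using E_eq Z'(1) by blast
    have "?Z = {}"
    proof (rule ccontr)
      assume "?Z \<noteq> {}"
      then obtain x where x: "x \<in> ?Z" by blast
      then obtain f where f: "partner x f" using partnerE Z'(1) by blast
      then have "f \<in> ?Z" using even_set_partner[OF Z f] x by blast
      then show False using odd_set_partner[OF C(1) f] x ZC by blast
    qed
    then show "D = D'" by blast
  qed
  then have "card odd_sets \<le> card (UNIV :: (bool \<times> bool) set)" by (rule card_inj_on_le) auto
  also have "\<dots> = 4" by (simp add: card_UNIV_bool UNIV_Times_UNIV[symmetric] del: UNIV_Times_UNIV)
  finally show ?thesis .
qed

end


section \<open>Rings of even cycles\<close>

definition glued :: "nat \<Rightarrow> (nat \<Rightarrow> nat) \<Rightarrow> (nat \<Rightarrow> nat) \<Rightarrow> ((nat \<times> nat) \<times> (nat \<times> nat)) set" where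
  "glued k x y = {((i, y i), (Suc i mod k, x (Suc i mod k))) | i. i < k}"

text \<open>A map from the vertices of the disjoint cycles onto \<open>G\<close> whose fibres are the glued pairs; it
  represents an isomorphism from the quotient without mentioning equivalence classes.\<close>

definition ring_map ::
  "'a graph \<Rightarrow> nat \<Rightarrow> (nat \<Rightarrow> nat) \<Rightarrow> (nat \<Rightarrow> nat) \<Rightarrow> (nat \<Rightarrow> nat) \<Rightarrow> (nat \<Rightarrow> nat \<Rightarrow> 'a) \<Rightarrow> bool" where
  "ring_map G k n x y \<phi> \<longleftrightarrow>
     verts G = (\<Union>i<k. \<phi> i ` {..<2 * n i}) \<and>
     edges G = (\<Union>i<k. cycle_edges (\<phi> i) (2 * n i)) \<and>
     (\<forall>i<k. \<phi> i (y i) = \<phi> (Suc i mod k) (x (Suc i mod k))) \<and>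
     (\<forall>i<k. \<forall>j<2 * n i. \<forall>i'<k. \<forall>j'<2 * n i'. \<phi> i j = \<phi> i' j' \<longrightarrow>
        (i, j) = (i', j') \<or> ((i, j), (i', j')) \<in> glued k x y \<or> ((i', j'), (i, j)) \<in> glued k x y)"

lemma ring_mapD:
  assumes "ring_map G k n x y \<phi>"
  shows "verts G = (\<Union>i<k. \<phi> i ` {..<2 * n i})"
    and "edges G = (\<Union>i<k. cycle_edges (\<phi> i) (2 * n i))"
    and "i < k \<Longrightarrow> \<phi> i (y i) = \<phi> (Suc i mod k) (x (Suc i mod k))"
    and "i < k \<Longrightarrow> j < 2 * n i \<Longrightarrow> i' < k \<Longrightarrow> j' < 2 * n i' \<Longrightarrow> \<phi> i j = \<phi> i' j' \<Longrightarrow>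
      (i, j) = (i', j') \<or> ((i, j), (i', j')) \<in> glued k x y \<or> ((i', j'), (i, j)) \<in> glued k x y"
proof -
  note r = assms[unfolded ring_map_def]
  note r2 = r[THEN conjunct2]
  note r3 = r2[THEN conjunct2]
  show "verts G = (\<Union>i<k. \<phi> i ` {..<2 * n i})" using r by (rule conjunct1)
  show "edges G = (\<Union>i<k. cycle_edges (\<phi> i) (2 * n i))" using r2 by (rule conjunct1)
  show "i < k \<Longrightarrow> \<phi> i (y i) = \<phi> (Suc i mod k) (x (Suc i mod k))"
    by (rule r3[THEN conjunct1, rule_format])
  show "i < k \<Longrightarrow> j < 2 * n i \<Longrightarrow> i' < k \<Longrightarrow> j' < 2 * n i' \<Longrightarrow> \<phi> i j = \<phi> i' j' \<Longrightarrow>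
      (i, j) = (i', j') \<or> ((i, j), (i', j')) \<in> glued k x y \<or> ((i', j'), (i, j)) \<in> glued k x y"
    by (rule r3[THEN conjunct2, rule_format])
qed

lemma Suc_mod_inj: "i < k \<Longrightarrow> j < k \<Longrightarrow> Suc i mod k = Suc j mod k \<Longrightarrow> i = j" for i j k :: nat
  by (auto simp: mod_Suc split: if_splits)

lemma glued_closure:
  assumes "\<And>i. i < k \<Longrightarrow> x i \<noteq> y i" "(p, q) \<in> (glued k x y \<union> (glued k x y)\<inverse>)\<^sup>*"
  shows "p = q \<or> (p, q) \<in> glued k x y \<or> (q, p) \<in> glued k x y"
  using assms(2)
proof (induction rule: rtrancl_induct)
  case (step q r)
  have chain: False if "(a, b) \<in> glued k x y" "(b, c) \<in> glued k x y" for a b c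
  proof -
    obtain i where "i < k" "b = (Suc i mod k, x (Suc i mod k))" using \<open>(a, b) \<in> glued k x y\<close> unfolding glued_def by auto
    moreover obtain j where "j < k" "b = (j, y j)" using \<open>(b, c) \<in> glued k x y\<close> unfolding glued_def by auto
    ultimately show False using assms(1)[of j] by auto
  qed
  have left: "a = b" if "(a, c) \<in> glued k x y" "(b, c) \<in> glued k x y" for a b c
    using that Suc_mod_inj unfolding glued_def by auto
  have right: "b = c" if "(a, b) \<in> glued k x y" "(a, c) \<in> glued k x y" for a b c
    using that unfolding glued_def by auto
  show ?case using step(2,3) chain left right by blast
qed simp

lemma cycle_ring_verts:
  "verts (cycle_ring k n x y) =
     (SIGMA i:{..<k}. {..<2 * n i}) // (glued k x y \<union> (glued k x y)\<inverse>)\<^sup>*"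
  unfolding cycle_ring_def identify_def disjoint_union_def glued_def cycle_graph_def Let_def by simp

lemma cycle_ring_edges:
  "edges (cycle_ring k n x y) =
     (\<lambda>e. (\<lambda>v. (glued k x y \<union> (glued k x y)\<inverse>)\<^sup>* `` {v}) ` e) `
       (\<Union>i<k. (\<lambda>e. Pair i ` e) ` edges (cycle_graph (2 * n i)))"
  unfolding cycle_ring_def identify_def disjoint_union_def glued_def Let_def by simp

lemma isomorphic_cycle_ring_iff:
  fixes G :: "'a graph"
  assumes xy: "\<And>i. i < k \<Longrightarrow> x i < 2 * n i \<and> y i < 2 * n i \<and> x i \<noteq> y i"
  shows "isomorphic (cycle_ring k n x y) G \<longleftrightarrow> (\<exists>\<phi>. ring_map G k n x y \<phi>)"
proof -
  define R where "R = (glued k x y \<union> (glued k x y)\<inverse>)\<^sup>*"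
  define D where "D = (SIGMA i:{..<k}. {..<2 * n i})"
  have equivR: "equiv UNIV R"
    unfolding R_def by (intro equivI) (auto simp: refl_rtrancl trans_rtrancl sym_rtrancl sym_Un_converse)
  have edge_image: "(\<lambda>e. f ` e) ` edges (cycle_ring k n x y) = (\<Union>i<k. cycle_edges (\<lambda>j. f (R `` {(i, j)})) (2 * n i))"
    for f :: "(nat \<times> nat) set \<Rightarrow> 'a"
    unfolding cycle_ring_edges R_def[symmetric] cycle_edges_image by (simp add: image_UN image_image)
  have vertsD: "verts (cycle_ring k n x y) = (\<lambda>p. R `` {p}) ` D"
    unfolding cycle_ring_verts R_def[symmetric] D_def[symmetric] quotient_def by auto
  show ?thesis
  proof
    assume "isomorphic (cycle_ring k n x y) G"
    then obtain f where f: "bij_betw f (verts (cycle_ring k n x y)) (verts G)"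
      "edges G = (\<lambda>e. f ` e) ` edges (cycle_ring k n x y)" unfolding isomorphic_def by blast
    define \<phi> where "\<phi> i j = f (R `` {(i, j)})" for i j
    have "ring_map G k n x y \<phi>"
      unfolding ring_map_def
    proof (intro conjI allI impI)
      show "verts G = (\<Union>i<k. \<phi> i ` {..<2 * n i})"
      proof -
        have "verts G = (\<lambda>p. f (R `` {p})) ` D" using f(1) unfolding bij_betw_def vertsD image_image by simp
        also have "\<dots> = (\<Union>i<k. (\<lambda>j. f (R `` {(i, j)})) ` {..<2 * n i})" unfolding D_def by force
        finally show ?thesis unfolding \<phi>_def .
      qed
      show "edges G = (\<Union>i<k. cycle_edges (\<phi> i) (2 * n i))"
        unfolding f(2) edge_image \<phi>_def ..
    next
      fix i assume "i < k"
      then have "((i, y i), (Suc i mod k, x (Suc i mod k))) \<in> R"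
        unfolding R_def glued_def by (intro r_into_rtrancl) auto
      then show "\<phi> i (y i) = \<phi> (Suc i mod k) (x (Suc i mod k))"
        unfolding \<phi>_def using equiv_class_eq[OF equivR] by metis
    next
      fix i j i' j' assume ij: "i < k" "j < 2 * n i" "i' < k" "j' < 2 * n i'" "\<phi> i j = \<phi> i' j'"
      have "(i, j) \<in> D" "(i', j') \<in> D" using ij unfolding D_def by auto
      then have "R `` {(i, j)} = R `` {(i', j')}"
        using f(1) ij(5) unfolding bij_betw_def vertsD \<phi>_def by (meson imageI inj_onD)
      then have "((i, j), (i', j')) \<in> R" using eq_equiv_class[OF _ equivR] by blast
      then show "(i, j) = (i', j') \<or> ((i, j), (i', j')) \<in> glued k x y \<or> ((i', j'), (i, j)) \<in> glued k x y"
        unfolding R_def using glued_closure[of k x y] xy by blast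
    qed
    then show "\<exists>\<phi>. ring_map G k n x y \<phi>" by blast
  next
    assume "\<exists>\<phi>. ring_map G k n x y \<phi>"
    then obtain \<phi> where "ring_map G k n x y \<phi>" by blast
    note r = ring_mapD[OF this]
    define \<psi> where "\<psi> p = \<phi> (fst p) (snd p)" for p
    have const: "\<psi> p = \<psi> q" if "(p, q) \<in> R" for p q
      using that unfolding R_def
    proof (induction rule: rtrancl_induct)
      case (step q r)
      then have "\<psi> q = \<psi> r" using assms(1) r(3) unfolding glued_def \<psi>_def by auto
      then show ?case using step by simp
    qed simp
    define f where "f X = \<psi> (SOME p. p \<in> X)" for X
    have f: "f (R `` {p}) = \<psi> p" for p
    proof -
      have "p \<in> R `` {p}" unfolding R_def by simp
      then have "(SOME q. q \<in> R `` {p}) \<in> R `` {p}" by (rule someI)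
      then show ?thesis unfolding f_def using const by fastforce
    qed
    have "inj_on f ((\<lambda>p. R `` {p}) ` D)"
    proof (rule inj_onI)
      fix X Y assume "X \<in> (\<lambda>p. R `` {p}) ` D" "Y \<in> (\<lambda>p. R `` {p}) ` D" "f X = f Y"
      then obtain p q where pq: "p \<in> D" "q \<in> D" "X = R `` {p}" "Y = R `` {q}" "\<psi> p = \<psi> q" using f by auto
      then have "p = q \<or> (p, q) \<in> glued k x y \<or> (q, p) \<in> glued k x y"
        using r(4)[of "fst p" "snd p" "fst q" "snd q"] unfolding D_def \<psi>_def by auto
      then have "(p, q) \<in> R" unfolding R_def by (auto intro: r_into_rtrancl)
      then show "X = Y" using pq equiv_class_eq[OF equivR] by simp
    qed
    moreover have "f ` ((\<lambda>p. R `` {p}) ` D) = verts G"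
      unfolding image_image f r(1) D_def \<psi>_def by force
    ultimately have "bij_betw f (verts (cycle_ring k n x y)) (verts G)"
      unfolding bij_betw_def vertsD by simp
    moreover have "edges G = (\<lambda>e. f ` e) ` edges (cycle_ring k n x y)"
      unfolding edge_image f r(2) \<psi>_def by simp
    ultimately show "isomorphic (cycle_ring k n x y) G" unfolding isomorphic_def by blast
  qed
qed

text \<open>In an even cycle every edge joins an even and an odd number, so distances have the parity of
  the sum of the two vertices.\<close>

lemma cycle_graph_edge_parity:
  assumes "even m" "{a, b} \<in> edges (cycle_graph m)"
  shows "odd (a + b)"
proof -
  obtain j where j: "j < m" "{a, b} = {j, Suc j mod m}" using assms(2) unfolding cycle_graph_def by auto
  have "even (Suc j mod m) \<longleftrightarrow> even (Suc j)" using assms(1) by (simp add: dvd_mod_iff)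
  moreover have "(a = j \<and> b = Suc j mod m) \<or> (b = j \<and> a = Suc j mod m)"
    using j(2) by (auto simp: doubleton_eq_iff)
  ultimately show ?thesis by auto
qed

lemma odd_graph_dist_cycle:
  assumes m: "even m" and uv: "u < m" "v < m"
  shows "odd (graph_dist (cycle_graph m) u v) \<longleftrightarrow> odd (u + v)"
proof -
  let ?adj = "\<lambda>a b. {a, b} \<in> edges (cycle_graph m)"
  have up: "is_path (cycle_graph m) a [a..<Suc b] b" if "a \<le> b" "b < m" for a b
  proof -
    have "{c, Suc c} \<in> edges (cycle_graph m)" if "Suc c < m" for c
      using that unfolding cycle_graph_def by (auto intro!: exI[of _ c])
    then have "successively ?adj [a..<Suc b]"
      using that unfolding successively_conv_nth by (auto simp del: upt_Suc)
    moreover have "hd [a..<Suc b] = a" "last [a..<Suc b] = b" using that by (auto simp: hd_append)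
    ultimately show ?thesis using that unfolding is_path_def by (auto simp: cycle_graph_def)
  qed
  have rev: "is_path (cycle_graph m) b (rev p) a" if "is_path (cycle_graph m) a p b" for a b p
    using that unfolding is_path_def
    by (auto simp: hd_rev last_rev successively_rev insert_commute)
  have "\<exists>p. is_path (cycle_graph m) u p v"
    using up[of u v] rev[OF up[of v u]] uv by (meson nat_le_linear)
  then obtain p where "is_path (cycle_graph m) u p v" by blast
  then have "\<exists>p. is_path (cycle_graph m) u p v \<and> length p = Suc (length p - 1)"
    unfolding is_path_def by (intro exI[of _ p]) auto
  then obtain p where p: "is_path (cycle_graph m) u p v" "length p = Suc (graph_dist (cycle_graph m) u v)"
    unfolding graph_dist_def using LeastI_ex[of "\<lambda>l. \<exists>p. is_path (cycle_graph m) u p v \<and> length p = Suc l"] by blast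
  have "odd (hd q + last q) \<longleftrightarrow> even (length q)" if "q \<noteq> []" "successively ?adj q" for q
    using that
  proof (induction q rule: induct_list012)
    case (3 a b q)
    then have "odd (a + b)" using cycle_graph_edge_parity[OF m] by simp
    moreover have "odd (b + last (b # q)) \<longleftrightarrow> even (length (b # q))" using "3.IH"(2) "3.prems" by simp
    ultimately show ?case by auto
  qed auto
  from this[of p] show ?thesis using p unfolding is_path_def by auto
qed

lemma odd_sum_cong:
  fixes f g :: "'a \<Rightarrow> nat"
  assumes "finite A" "\<And>a. a \<in> A \<Longrightarrow> odd (f a) \<longleftrightarrow> odd (g a)"
  shows "odd (sum f A) \<longleftrightarrow> odd (sum g A)"
proof -
  have "{a \<in> A. odd (f a)} = {a \<in> A. odd (g a)}" using assms(2) by auto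
  then show ?thesis using even_sum_iff[OF assms(1), of f] even_sum_iff[OF assms(1), of g] by simp
qed

lemma in_family_E_iff:
  "in_family_E G \<longleftrightarrow> (\<exists>k n x y \<phi>. k \<ge> 3 \<and>
     (\<forall>i<k. n i \<ge> 2 \<and> x i < 2 * n i \<and> y i < 2 * n i \<and> x i \<noteq> y i) \<and>
     odd (\<Sum>i<k. x i + y i) \<and> ring_map G k n x y \<phi>)"
proof -
  have vs: "verts (cycle_graph m) = {..<m}" for m by (simp add: cycle_graph_def)
  have "(k \<ge> 3 \<and> (\<forall>i<k. n i \<ge> 2 \<and> x i < 2 * n i \<and> y i < 2 * n i \<and> x i \<noteq> y i) \<and>
      odd (\<Sum>i<k. graph_dist (cycle_graph (2 * n i)) (x i) (y i)) \<and> isomorphic (cycle_ring k n x y) G)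
    \<longleftrightarrow> (\<exists>\<phi>. k \<ge> 3 \<and> (\<forall>i<k. n i \<ge> 2 \<and> x i < 2 * n i \<and> y i < 2 * n i \<and> x i \<noteq> y i) \<and>
      odd (\<Sum>i<k. x i + y i) \<and> ring_map G k n x y \<phi>)"
    (is "_ \<and> ?A \<and> _ \<and> _ \<longleftrightarrow> _") for k and n x y :: "nat \<Rightarrow> nat"
  proof (cases ?A)
    case True
    then have "odd (\<Sum>i<k. graph_dist (cycle_graph (2 * n i)) (x i) (y i)) \<longleftrightarrow> odd (\<Sum>i<k. x i + y i)"
      by (intro odd_sum_cong odd_graph_dist_cycle) auto
    moreover have "isomorphic (cycle_ring k n x y) G \<longleftrightarrow> (\<exists>\<phi>. ring_map G k n x y \<phi>)"
      using True by (intro isomorphic_cycle_ring_iff) auto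
    ultimately show ?thesis by blast
  qed blast
  then show ?thesis unfolding in_family_E_def vs lessThan_iff by (simp only:)
qed


section \<open>Rings are critical and have at least five odd cycles\<close>

text \<open>Starting from 0 in both directions, the colours alternate up to the ends of the exceptional edge;
  that the two directions agree is due to the even length.\<close>

lemma almost_proper_alternates:
  fixes c :: "nat \<Rightarrow> bool"
  assumes m: "even m" and proper: "\<And>j. j < m \<Longrightarrow> j \<noteq> j0 \<Longrightarrow> c j \<noteq> c (Suc j mod m)"
    and ab: "a < m" "b < m"
  shows "c a = c b \<longleftrightarrow> even (a + b)"
proof -
  have up: "c a \<longleftrightarrow> (even a \<longleftrightarrow> c 0)" if "a \<le> j0" "a < m" for a
    using that
  proof (induction a)
    case (Suc a)
    then show ?case using proper[of a] by auto
  qed simp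
  have down: "c (m - Suc d) \<longleftrightarrow> (even (m - Suc d) \<longleftrightarrow> c 0)" if "d < m" "j0 < m - Suc d" for d
    using that
  proof (induction d)
    case 0
    then have "Suc (m - 1) mod m = 0" by simp
    then show ?case using proper[of "m - 1"] 0 m by auto
  next
    case (Suc d)
    have "Suc (m - Suc (Suc d)) = m - Suc d" using Suc.prems by simp
    moreover have "m - Suc d < m" using Suc.prems by simp
    ultimately have "c (m - Suc (Suc d)) \<noteq> c (m - Suc d)"
      using proper[of "m - Suc (Suc d)"] Suc.prems by auto
    moreover have "even (m - Suc d) \<noteq> even (m - Suc (Suc d))"
      using \<open>Suc (m - Suc (Suc d)) = m - Suc d\<close> by (metis even_Suc)
    moreover have "c (m - Suc d) \<longleftrightarrow> (even (m - Suc d) \<longleftrightarrow> c 0)" using Suc.IH Suc.prems by simp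
    ultimately show ?case by argo
  qed
  have "c a \<longleftrightarrow> (even a \<longleftrightarrow> c 0)" if "a < m" for a
  proof (cases "a \<le> j0")
    case False
    moreover have "m - Suc (m - Suc a) = a" using that by simp
    ultimately show ?thesis using down[of "m - Suc a"] that by simp
  qed (use up that in blast)
  from this[OF ab(1)] this[OF ab(2)] show ?thesis by (metis even_add)
qed

lemma cyclic_parity:
  fixes w :: "nat \<Rightarrow> bool" and f :: "nat \<Rightarrow> nat"
  assumes "k > 0" "\<And>i. i < k \<Longrightarrow> w i = w (Suc i mod k) \<longleftrightarrow> even (f i)"
  shows "even (\<Sum>i<k. f i)"
proof -
  have "even (\<Sum>i<l. f i) \<longleftrightarrow> w 0 = w (l mod k)" if "l \<le> k" for l
    using that
  proof (induction l)
    case (Suc l)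
    then show ?case using assms(2)[of l] by auto
  qed simp
  from this[of k] show ?thesis by simp
qed

text \<open>\<open>t j\<close> is the position of \<open>j\<close> on the path that remains of the cycle without the edge from \<open>j0\<close> to
  its successor.\<close>

lemma cut_position:
  fixes j0 m :: nat
  assumes "j0 < m"
  defines "t \<equiv> \<lambda>j. (j + (m - Suc j0)) mod m"
  shows "inj_on t {..<m}" and "\<And>j. j < m \<Longrightarrow> j \<noteq> j0 \<Longrightarrow> t (Suc j mod m) = Suc (t j)"
    and "t (Suc j0 mod m) = 0"
proof -
  show inj: "inj_on t {..<m}"
    unfolding t_def using cycle_edges_rotate(1)[of id m "m - Suc j0"] assms(1) by simp
  have S: "t (Suc j mod m) = Suc (t j) mod m" for j unfolding t_def by (simp add: mod_simps)
  have tj0: "t j0 = m - 1" unfolding t_def using assms(1) by simp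
  show "t (Suc j0 mod m) = 0" unfolding S tj0 using assms(1) by simp
  fix j assume j: "j < m" "j \<noteq> j0"
  have "t j \<noteq> m - 1" using inj_onD[OF inj, of j j0] tj0 j assms(1) by auto
  moreover have "t j < m" unfolding t_def using assms(1) by simp
  ultimately show "t (Suc j mod m) = Suc (t j)" unfolding S by simp
qed

locale ring =
  fixes G :: "'a graph" and k :: nat and n x y :: "nat \<Rightarrow> nat" and \<phi> :: "nat \<Rightarrow> nat \<Rightarrow> 'a"
  assumes simple: "simple_graph G" and k: "k \<ge> 3"
    and ends: "\<And>i. i < k \<Longrightarrow> n i \<ge> 2 \<and> x i < 2 * n i \<and> y i < 2 * n i \<and> x i \<noteq> y i"
    and odd_sum: "odd (\<Sum>i<k. x i + y i)"
    and ring_map: "ring_map G k n x y \<phi>"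
begin

abbreviation ring_cycle :: "nat \<Rightarrow> 'a set set" where
  "ring_cycle i \<equiv> cycle_edges (\<phi> i) (2 * n i)"

abbreviation ring_edge :: "nat \<Rightarrow> nat \<Rightarrow> 'a set" where
  "ring_edge i j \<equiv> {\<phi> i j, \<phi> i (Suc j mod (2 * n i))}"

lemmas verts_eq = ring_mapD(1)[OF ring_map]
  and edges_eq = ring_mapD(2)[OF ring_map]
  and glue = ring_mapD(3)[OF ring_map]
  and fibres = ring_mapD(4)[OF ring_map]

lemma ring_edge_in: "i < k \<Longrightarrow> j < 2 * n i \<Longrightarrow> ring_edge i j \<in> edges G"
  unfolding edges_eq cycle_edges_def by blast

lemma edgeE:
  assumes "e \<in> edges G" obtains i j where "i < k" "j < 2 * n i" "e = ring_edge i j"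
  using assms unfolding edges_eq cycle_edges_def by auto

lemma phi_inj: 
  assumes "i < k" shows "inj_on (\<phi> i) {..<2 * n i}"
proof (rule inj_onI)
  fix j j' assume "j \<in> {..<2 * n i}" "j' \<in> {..<2 * n i}" "\<phi> i j = \<phi> i j'"
  then have "(i, j) = (i, j') \<or> ((i, j), (i, j')) \<in> glued k x y \<or> ((i, j'), (i, j)) \<in> glued k x y"
    using fibres assms by auto
  moreover have "Suc i mod k \<noteq> i" using assms k by (auto simp: mod_Suc)
  ultimately show "j = j'" unfolding glued_def by auto
qed

lemma ring_cycle_is_cycle: "i < k \<Longrightarrow> is_cycle (ring_cycle i)"
  unfolding is_cycle_def using phi_inj[of i] ends[of i] by (intro exI[of _ "\<phi> i"] exI[of _ "2 * n i"]) auto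

lemma card_ring_cycle: "i < k \<Longrightarrow> card (ring_cycle i) = 2 * n i"
  using card_cycle_edges[of "2 * n i" "\<phi> i"] phi_inj[of i] ends[of i] by simp

lemma ring_edge_inj:
  "i < k \<Longrightarrow> j < 2 * n i \<Longrightarrow> j' < 2 * n i \<Longrightarrow> ring_edge i j = ring_edge i j' \<Longrightarrow> j = j'"
  using cycle_edge_inj[of "2 * n i" "\<phi> i" j j'] phi_inj[of i] ends[of i] by simp

text \<open>Two different cycles with two common vertices would follow each other in both directions, so
  that \<open>k = 2\<close>.\<close>

lemma ring_cycles_disjoint:
  assumes "i < k" "i' < k" "i \<noteq> i'"
  shows "ring_cycle i \<inter> ring_cycle i' = {}"
proof (rule ccontr)
  assume "ring_cycle i \<inter> ring_cycle i' \<noteq> {}"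
  then obtain j j' where j: "j < 2 * n i" "j' < 2 * n i'" "ring_edge i j = ring_edge i' j'"
    unfolding cycle_edges_def by auto
  let ?s = "Suc j mod (2 * n i)" and ?s' = "Suc j' mod (2 * n i')"
  have lt: "?s < 2 * n i" "?s' < 2 * n i'" using j by simp_all
  have "j \<noteq> ?s" using j(1) ends[OF assms(1)] by (auto simp: mod_Suc split: if_splits)
  obtain a b where ab: "a < 2 * n i'" "b < 2 * n i'" "\<phi> i j = \<phi> i' a" "\<phi> i ?s = \<phi> i' b"
  proof -
    have "\<phi> i j = \<phi> i' j' \<and> \<phi> i ?s = \<phi> i' ?s' \<or> \<phi> i j = \<phi> i' ?s' \<and> \<phi> i ?s = \<phi> i' j'"
      using j(3) by (simp only: doubleton_eq_iff)
    then show thesis using that[of j' ?s'] that[of ?s' j'] j(2) lt(2) by argo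
  qed
  have "((i, j), (i', a)) \<in> glued k x y \<or> ((i', a), (i, j)) \<in> glued k x y"
    using fibres[OF assms(1) j(1) assms(2) ab(1,3)] assms(3) by auto
  moreover have "((i, ?s), (i', b)) \<in> glued k x y \<or> ((i', b), (i, ?s)) \<in> glued k x y"
    using fibres[OF assms(1) lt(1) assms(2) ab(2,4)] assms(3) by auto
  ultimately have "i' = Suc i mod k" "i = Suc i' mod k"
    using \<open>j \<noteq> ?s\<close> unfolding glued_def by auto
  then show False using k assms by (auto simp: mod_Suc split: if_splits)
qed

lemma no_isolated: "no_isolated G"
  unfolding no_isolated_def
proof
  fix v assume "v \<in> verts G"
  then obtain i j where "i < k" "j < 2 * n i" "v = \<phi> i j" unfolding verts_eq by auto
  then show "\<exists>e\<in>edges G. v \<in> e" using ring_edge_in by (intro bexI[of _ "ring_edge i j"]) auto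
qed

text \<open>Without one edge, a two-colouring still alternates on each of the cycles, so that the colours
  of successive gluing vertices differ exactly at odd distances; around the ring, the number of
  these is even.\<close>

lemma not_two_colorable_minus_edge:
  assumes "e \<in> edges G"
  shows "\<not> two_colorable (edges G - {e})"
proof
  assume "two_colorable (edges G - {e})"
  then obtain c :: "'a \<Rightarrow> bool" where c: "\<And>u v. {u, v} \<in> edges G - {e} \<Longrightarrow> c u \<noteq> c v"
    unfolding two_colorable_def by blast
  have alt: "c (\<phi> i (x i)) = c (\<phi> i (y i)) \<longleftrightarrow> even (x i + y i)" if i: "i < k" for i
  proof -
    obtain j0 where j0: "\<And>j. j < 2 * n i \<Longrightarrow> j \<noteq> j0 \<Longrightarrow> ring_edge i j \<noteq> e"
    proof (cases "\<exists>j0<2 * n i. ring_edge i j0 = e")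
      case True
      then show thesis using that ring_edge_inj[OF i] by metis
    next
      case False
      then show thesis using that by blast
    qed
    show ?thesis
    proof (rule almost_proper_alternates[of "2 * n i" j0 "\<lambda>j. c (\<phi> i j)"])
      show "c (\<phi> i j) \<noteq> c (\<phi> i (Suc j mod (2 * n i)))" if "j < 2 * n i" "j \<noteq> j0" for j
        using c[of "\<phi> i j" "\<phi> i (Suc j mod (2 * n i))"] ring_edge_in[OF i that(1)] j0[OF that] by simp
    qed (use ends[OF i] in auto)
  qed
  have "even (\<Sum>i<k. x i + y i)"
  proof (rule cyclic_parity)
    show "c (\<phi> i (x i)) = c (\<phi> (Suc i mod k) (x (Suc i mod k))) \<longleftrightarrow> even (x i + y i)" if "i < k" for i
      using alt[OF that] glue[OF that] by simp
  qed (use k in simp)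
  then show False using odd_sum by simp
qed

lemma two_colorableI:
  fixes c :: "nat \<Rightarrow> nat \<Rightarrow> bool"
  assumes glue_c: "\<And>i. i < k \<Longrightarrow> c i (y i) = c (Suc i mod k) (x (Suc i mod k))"
    and proper: "\<And>i j. i < k \<Longrightarrow> j < 2 * n i \<Longrightarrow> ring_edge i j \<notin> F \<Longrightarrow> c i j \<noteq> c i (Suc j mod (2 * n i))"
  shows "two_colorable (edges G - F)"
proof -
  define d where "d v = (\<exists>i<k. \<exists>j<2 * n i. v = \<phi> i j \<and> c i j)" for v
  have d: "d (\<phi> i j) = c i j" if "i < k" "j < 2 * n i" for i j
  proof -
    have "c i' j' = c i j" if "i' < k" "j' < 2 * n i'" "\<phi> i j = \<phi> i' j'" for i' j'
      using fibres[OF \<open>i < k\<close> \<open>j < 2 * n i\<close> that] glue_c unfolding glued_def by auto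
    then show ?thesis unfolding d_def using that by blast
  qed
  have "d u \<noteq> d v" if uv: "{u, v} \<in> edges G - F" for u v
  proof -
    obtain i j where ij: "i < k" "j < 2 * n i" "{u, v} = ring_edge i j" using uv edgeE by blast
    have "Suc j mod (2 * n i) < 2 * n i" using ij(2) by simp
    then have "d (\<phi> i j) \<noteq> d (\<phi> i (Suc j mod (2 * n i)))"
      using proper[OF ij(1,2)] d[OF ij(1)] ij uv by auto
    then show ?thesis using ij(3) by (auto simp: doubleton_eq_iff)
  qed
  then show ?thesis unfolding two_colorable_def by blast
qed

text \<open>Cut the cycle \<open>i0\<close> open at the given edge. Exchanging the colours up to the first of its two
  gluing vertices changes the parity of the ring, at the cost of the edge after that vertex.\<close>

lemma two_colorable_minus_two:
  assumes i0: "i0 < k" and j0: "j0 < 2 * n i0"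
  obtains j1 where "j1 < 2 * n i0" "two_colorable (edges G - {ring_edge i0 j0, ring_edge i0 j1})"
    "Suc j0 mod (2 * n i0) = x i0 \<Longrightarrow> j1 = x i0"
proof -
  let ?m = "2 * n i0"
  define t where "t j = (j + (?m - Suc j0)) mod ?m" for j
  note t = cut_position[OF j0, folded t_def]
  have xy: "x i0 < ?m" "y i0 < ?m" "x i0 \<noteq> y i0" using ends[OF i0] by auto
  have t_inj: "t a = t b \<longleftrightarrow> a = b" if "a < ?m" "b < ?m" for a b
    using t(1) that by (meson lessThan_iff inj_onD)
  define j1 where "j1 = (if t (x i0) \<le> t (y i0) then x i0 else y i0)"
  have j1: "j1 < ?m" using xy unfolding j1_def by auto
  define fl where "fl j \<longleftrightarrow> t j \<le> t j1" for j
  have fl_xy: "fl (x i0) \<noteq> fl (y i0)"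
    using t_inj[OF xy(1,2)] xy(3) unfolding fl_def j1_def by auto
  have fl_step: "fl j = fl (Suc j mod ?m)" if "j < ?m" "j \<noteq> j0" "j \<noteq> j1" for j
    using t(2)[OF that(1,2)] t_inj[OF that(1) j1] that(3) unfolding fl_def by auto
  \<comment> \<open>\<open>W i\<close> has the parity of the walk from the first gluing vertex of cycle 0 to that of cycle \<open>i\<close>,
    corrected by one past the cycle \<open>i0\<close>.\<close>
  define W where "W i = (\<Sum>l<i. x l + y l + of_bool (l = i0))" for i
  define c where "c i j = odd (W i + x i + j + of_bool (i = i0 \<and> fl j \<noteq> fl (x i0)))" for i j
  have "two_colorable (edges G - {ring_edge i0 j0, ring_edge i0 j1})"
  proof (rule two_colorableI[of c])
    fix i assume i: "i < k"
    have "W (Suc i) = W i + x i + y i + of_bool (i = i0)" unfolding W_def by simp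
    moreover have "i = i0 \<and> fl (y i) \<noteq> fl (x i0) \<longleftrightarrow> i = i0" using fl_xy by auto
    ultimately have l: "c i (y i) \<longleftrightarrow> odd (W (Suc i))" unfolding c_def by simp
    have r: "c i' (x i') \<longleftrightarrow> odd (W i')" for i' unfolding c_def by auto
    show "c i (y i) = c (Suc i mod k) (x (Suc i mod k))"
    proof (cases "Suc i = k")
      case True
      have "(\<Sum>l<k. x l + y l + of_bool (l = i0)) = (\<Sum>l<k. x l + y l) + (\<Sum>l<k. of_bool (l = i0))"
        by (simp add: sum.distrib)
      moreover have "(\<Sum>l<k. of_bool (l = i0)) = (1::nat)" using i0 by (simp add: of_bool_def)
      ultimately have "even (W k)" unfolding W_def using odd_sum by simp
      moreover have "even (W 0)" unfolding W_def by simp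
      ultimately show ?thesis unfolding l r using True by simp
    next
      case False
      then show ?thesis unfolding l r using i by simp
    qed
  next
    fix i j assume ij: "i < k" "j < 2 * n i" "ring_edge i j \<notin> {ring_edge i0 j0, ring_edge i0 j1}"
    have par: "even (Suc j mod (2 * n i)) \<longleftrightarrow> even (Suc j)" by (simp add: dvd_mod_iff)
    have "(i = i0 \<and> fl j \<noteq> fl (x i0)) = (i = i0 \<and> fl (Suc j mod (2 * n i)) \<noteq> fl (x i0))"
    proof (cases "i = i0")
      case True
      then have "j \<noteq> j0" "j \<noteq> j1" using ij(3) by auto
      then show ?thesis using True fl_step[of j] ij(2) by simp
    qed simp
    then show "c i j \<noteq> c i (Suc j mod (2 * n i))" unfolding c_def using par by auto
  qed
  moreover have "j1 = x i0" if "Suc j0 mod ?m = x i0" using t(3) that unfolding j1_def by simp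
  ultimately show thesis using that[OF j1] by blast
qed

lemma three_colorable: "colorable G 3"
proof -
  have 0: "0 < k" using k by simp
  let ?m = "2 * n 0"
  have x0: "x 0 < ?m" using ends[OF 0] by simp
  define j0 where "j0 = (if x 0 = 0 then ?m - 1 else x 0 - 1)"
  have j0: "j0 < ?m" "Suc j0 mod ?m = x 0" using x0 unfolding j0_def by auto
  obtain j1 where j1: "two_colorable (edges G - {ring_edge 0 j0, ring_edge 0 j1})" "j1 = x 0"
    using two_colorable_minus_two[OF 0 j0(1)] j0(2) by metis
  then obtain c :: "'a \<Rightarrow> bool" where c: "\<And>u v. {u, v} \<in> edges G - {ring_edge 0 j0, ring_edge 0 (x 0)} \<Longrightarrow> c u \<noteq> c v"
    unfolding two_colorable_def by blast
  \<comment> \<open>Both edges left out contain the vertex \<open>\<phi> 0 (x 0)\<close>, which gets the third colour.\<close>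
  define d :: "'a \<Rightarrow> nat" where "d v = (if v = \<phi> 0 (x 0) then 2 else if c v then 1 else 0)" for v
  have "d u \<noteq> d v" if uv: "{u, v} \<in> edges G" for u v
  proof -
    have "card {u, v} = 2" using simple uv unfolding simple_graph_def by blast
    then have ne: "u \<noteq> v" by auto
    show ?thesis
    proof (cases "u = \<phi> 0 (x 0) \<or> v = \<phi> 0 (x 0)")
      case False
      then have "\<phi> 0 (x 0) \<notin> {u, v}" by auto
      then have "{u, v} \<notin> {ring_edge 0 j0, ring_edge 0 (x 0)}" using j0(2) by auto
      then have "c u \<noteq> c v" using c uv by blast
      then show ?thesis using False unfolding d_def by auto
    qed (use ne in \<open>auto simp: d_def\<close>)
  qed
  then show ?thesis unfolding colorable_def by (intro exI[of _ d]) (auto simp: d_def)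
qed

lemma critical_edges: "critical_edges (edges G)"
proof
  show "finite (edges G)" using finite_edges[OF simple] .
  show "card e = 2" if "e \<in> edges G" for e using simple that unfolding simple_graph_def by blast
  have "0 < k" "0 < 2 * n 0" using k ends[of 0] by auto
  then show "edges G \<noteq> {}" using ring_edge_in by blast
  show "\<not> two_colorable (edges G - {e})" if "e \<in> edges G" for e
    using not_two_colorable_minus_edge[OF that] .
  show "\<exists>f\<in>edges G. two_colorable (edges G - {e, f})" if "e \<in> edges G" for e
  proof -
    obtain i j where ij: "i < k" "j < 2 * n i" "e = ring_edge i j" using \<open>e \<in> edges G\<close> by (rule edgeE)
    obtain j1 where "j1 < 2 * n i" "two_colorable (edges G - {ring_edge i j, ring_edge i j1})"
      using two_colorable_minus_two[OF ij(1,2)] by blast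
    then show ?thesis using ring_edge_in[OF ij(1)] ij(3) by blast
  qed
qed

lemma critical: "critical_3_2 G"
proof -
  interpret critical_edges "edges G" using critical_edges .
  show ?thesis unfolding critical_iff[OF simple] using three_colorable nonempty stable has_partner by blast
qed

text \<open>Adding some of the even cycles of the ring to an odd cycle gives further odd cycles.\<close>

lemma five_odd_cycles: "card (odd_cycles G) \<ge> 5"
proof -
  interpret critical_edges "edges G" using critical_edges .
  have k3: "0 < k" "1 < k" "2 < k" using k by auto
  let ?A = "ring_cycle 0" and ?B = "ring_cycle 1" and ?C = "ring_cycle 2"
  have ev: "ring_cycle i \<in> even_sets" if "i < k" for i
    unfolding even_sets_def
    using cycle_even_degrees[OF ring_cycle_is_cycle[OF that]] card_ring_cycle[OF that] edges_eq that by auto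
  have ne: "?A \<noteq> {}" "?B \<noteq> {}" "?C \<noteq> {}" using cycle_nonempty ring_cycle_is_cycle k3 by blast+
  have disj: "?A \<inter> ?B = {}" "?A \<inter> ?C = {}" "?B \<inter> ?C = {}" using ring_cycles_disjoint k3 by simp_all
  obtain D where D: "D \<in> odd_sets" using nonempty odd_set_through by blast
  let ?X = "{{}, ?A, ?B, ?C, ?A \<union> ?B}"
  have "?A \<union> ?B = sym_diff ?A ?B" using disj by blast
  then have "?A \<union> ?B \<in> even_sets" using even_even_sym_diff[OF ev[OF k3(1)] ev[OF k3(2)]] by simp
  then have X: "?X \<subseteq> even_sets" using ev k3 by (auto simp: even_sets_def even_degrees_def)
  have inj: "inj_on (sym_diff D) ?X" by (rule inj_onI) blast
  have card_X: "card ?X = 5"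
  proof -
    have "?A \<noteq> ?B" "?A \<noteq> ?C" "?B \<noteq> ?C" "?A \<noteq> ?A \<union> ?B" "?B \<noteq> ?A \<union> ?B" "?C \<noteq> ?A \<union> ?B" "?A \<union> ?B \<noteq> {}"
      using ne disj by blast+
    then show ?thesis using ne by simp
  qed
  have "sym_diff D ` ?X \<subseteq> odd_sets" using odd_even_sym_diff[OF D] X by blast
  then have "5 \<le> card odd_sets" using card_inj_on_le[OF inj _ finite_odd_sets] card_X by metis
  then show ?thesis unfolding card_odd_cycles[OF simple] odd_sets_eq_odd_cycles .
qed

end


section \<open>Critical graphs with all degrees even are rings\<close>

text \<open>With the consecutive numbers from \<open>m\<close> on appended, the enumeration is strictly monotone on all
  natural numbers, and its value \<open>m\<close> closes the last of the intervals.\<close>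

lemma increasing_enumeration:
  assumes I: "I \<subseteq> {..<m::nat}" "0 \<in> I"
  obtains s where "strict_mono s" "s 0 = 0" "s (card I) = m"
    "\<forall>l<card I. s l \<in> I" "\<forall>l<card I. \<forall>j. s l < j \<longrightarrow> j < s (Suc l) \<longrightarrow> j \<notin> I"
proof -
  define xs where "xs = sorted_list_of_set I"
  have fin: "finite I" using I(1) finite_subset by blast
  have xs: "set xs = I" "length xs = card I" "sorted_wrt (<) xs"
    unfolding xs_def using fin by auto
  define s where "s l = (if l < card I then xs ! l else m + (l - card I))" for l
  have mono: "xs ! i < xs ! j" if "i < j" "j < card I" for i j
    using xs that by (simp add: sorted_wrt_iff_nth_less)
  have mem: "xs ! l \<in> I" if "l < card I" for l using that xs by (metis nth_mem)
  have step: "s l < s (Suc l)" for l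
    using mono[of l "Suc l"] mem[of l] I(1) unfolding s_def by auto
  have idx: "\<exists>i<card I. j = xs ! i" if "j \<in> I" for j using that xs by (metis in_set_conv_nth)
  show thesis
  proof (rule that[of s])
    show "strict_mono s" using step by (simp add: strict_mono_Suc_iff)
    obtain i where i: "i < card I" "0 = xs ! i" using idx[OF I(2)] by auto
    then have "i = 0" using mono[of 0 i] by (cases i) auto
    then show "s 0 = 0" using i unfolding s_def by simp
    show "s (card I) = m" unfolding s_def by simp
    show "\<forall>l<card I. s l \<in> I" using mem unfolding s_def by simp
    show "\<forall>l<card I. \<forall>j. s l < j \<longrightarrow> j < s (Suc l) \<longrightarrow> j \<notin> I"
    proof (intro allI impI notI)
      fix l j assume l: "l < card I" "s l < j" "j < s (Suc l)"
      assume "j \<in> I"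
      then obtain i where i: "i < card I" "j = s i" using idx unfolding s_def by auto
      have "strict_mono s" using step by (simp add: strict_mono_Suc_iff)
      then have "l < i" "i < Suc l" using l i(2) by (simp_all add: strict_mono_less)
      then show False by simp
    qed
  qed
qed

lemma enumeration_cover:
  assumes "s 0 = (0::nat)" "j < s q"
  shows "\<exists>l<q. s l \<le> j \<and> j < s (Suc l)"
  using assms(2)
proof (induction q)
  case (Suc q)
  show ?case
  proof (cases "j < s q")
    case True
    then show ?thesis using Suc.IH less_Suc_eq by blast
  next
    case False
    then show ?thesis using Suc.prems by (intro exI[of _ q]) auto
  qed
qed (use assms(1) in simp)

lemma enumeration_unique:
  assumes "strict_mono s" "s l \<le> (j::nat)" "j < s (Suc l)" "s l' \<le> j" "j < s (Suc l')"
  shows "l = l'"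
proof -
  have "s l < s (Suc l')" "s l' < s (Suc l)" using assms by linarith+
  then have "l < Suc l'" "l' < Suc l" using assms(1) by (simp_all add: strict_mono_less)
  then show ?thesis by simp
qed

lemma sum_differences:
  fixes s :: "nat \<Rightarrow> nat"
  assumes "strict_mono s"
  shows "(\<Sum>l<k. s (Suc l) - s l) = s k - s 0"
proof (induction k)
  case (Suc k)
  have "s 0 \<le> s k" "s k \<le> s (Suc k)" using assms by (simp_all add: strict_mono_less_eq)
  then show ?case using Suc by simp
qed simp

context critical_edges
begin

lemma complement_odd_set:
  assumes "even_degrees E" "C \<in> odd_sets"
  shows "E - C \<in> odd_sets"
proof -
  have C: "C \<subseteq> E" "even_degrees C" using assms(2) unfolding odd_sets_def by auto
  have "E - C = sym_diff E C" using C(1) by auto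
  then have ev: "even_degrees (E - C)"
    using even_degrees_sym_diff[OF finite_E subset_finite[OF C(1)] assms(1) C(2)] by simp
  obtain e f where ef: "partner e f" using nonempty partnerE by blast
  then have "e \<in> E" "f \<in> E" unfolding partner_def by auto
  then have "odd (card (E - C))"
    using odd_iff_one_partner[OF ef _ ev] odd_set_partner[OF assms(2) ef] by blast
  then show ?thesis unfolding odd_sets_def using ev by simp
qed

text \<open>At a vertex of \<open>C\<close> that does not lie on the other odd cycle, an odd set contains both edges of
  \<open>C\<close> or none. It is therefore determined by one edge of each arc of \<open>C\<close> between consecutive common
  vertices, and with fewer than three common vertices there would be at most four odd sets.\<close>

lemma three_common_vertices:
  assumes ev: "even_degrees E" and five: "card odd_sets \<ge> 5"
  obtains C \<gamma> m I where "C \<in> odd_sets" "m \<ge> 3" "inj_on \<gamma> {..<m}" "C = cycle_edges \<gamma> m"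
    "I = {j \<in> {..<m}. \<gamma> j \<in> \<Union>(E - C)}" "0 \<in> I" "card I \<ge> 3"
proof -
  obtain C where C: "C \<in> odd_sets" using nonempty odd_set_through by blast
  note cyc = odd_set_is_cycle[OF C]
  have "\<Union>C \<noteq> {}" using cycle_deg[OF cyc] card_edge C cycle_nonempty[OF cyc] 
    unfolding odd_sets_def by (metis (no_types, lifting) Sup_bot_conv(1) card.empty ex_in_conv mem_Collect_eq subsetD zero_neq_numeral)
  \<comment> \<open>Start the cycle at a common vertex if there is one, so that the first arc begins at 0.\<close>
  then obtain v where v: "v \<in> \<Union>C" "\<Union>C \<inter> \<Union>(E - C) \<noteq> {} \<Longrightarrow> v \<in> \<Union>(E - C)" by blast
  obtain \<gamma> p where g: "p \<ge> 2" "inj_on \<gamma> {..p}" "C = insert {\<gamma> p, \<gamma> 0} (path_edges \<gamma> p)" "\<gamma> 0 = v"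
    using cycle_startE[OF cyc v(1)] by metis
  define m where "m = Suc p"
  have m: "m \<ge> 3" "inj_on \<gamma> {..<m}" "C = cycle_edges \<gamma> m"
    using g cycle_edges_path[of p \<gamma>] unfolding m_def by (simp_all add: lessThan_Suc_atMost)
  define I where "I = {j \<in> {..<m}. \<gamma> j \<in> \<Union>(E - C)}"
  define \<epsilon> where "\<epsilon> j = {\<gamma> j, \<gamma> (Suc j mod m)}" for j
  have step: "\<epsilon> (Suc j) \<in> D \<longleftrightarrow> \<epsilon> j \<in> D" if D: "D \<in> odd_sets" and j: "Suc j < m" "Suc j \<notin> I" for D j
  proof (rule even_deg_two_edges[of D "\<gamma> (Suc j)"])
    show "even_degrees D" using D unfolding odd_sets_def by simp
    have "\<gamma> (Suc j) \<notin> \<Union>(E - C)" using j unfolding I_def by auto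
    then have "{e \<in> E. \<gamma> (Suc j) \<in> e} \<subseteq> {e \<in> C. \<gamma> (Suc j) \<in> e}" by blast
    also have "\<dots> \<subseteq> {\<epsilon> (Suc j), \<epsilon> j}"
      using cycle_edges_at[OF m(1,2), of "Suc j"] j(1) unfolding m(3) \<epsilon>_def by auto
    finally show "{e \<in> D. \<gamma> (Suc j) \<in> e} \<subseteq> {\<epsilon> (Suc j), \<epsilon> j}" using D unfolding odd_sets_def by blast
    show "\<gamma> (Suc j) \<in> \<epsilon> (Suc j)" "\<gamma> (Suc j) \<in> \<epsilon> j" using j(1) unfolding \<epsilon>_def by auto
    show "\<epsilon> (Suc j) \<noteq> \<epsilon> j"
      using cycle_edge_inj[OF m(1,2), of "Suc j" j] j(1) unfolding \<epsilon>_def by auto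
  qed
  \<comment> \<open>If there were no common vertex, 0 would stand for the whole cycle as a single arc.\<close>
  let ?I = "insert 0 I"
  have "inj_on (\<lambda>D. {j \<in> ?I. \<epsilon> j \<in> D}) odd_sets"
  proof (rule inj_onI)
    fix D D' assume D: "D \<in> odd_sets" "D' \<in> odd_sets" "{j \<in> ?I. \<epsilon> j \<in> D} = {j \<in> ?I. \<epsilon> j \<in> D'}"
    have eqI: "\<epsilon> j \<in> D \<longleftrightarrow> \<epsilon> j \<in> D'" if "j \<in> ?I" for j using D(3) that by blast
    have "\<epsilon> j \<in> D \<longleftrightarrow> \<epsilon> j \<in> D'" if "j < m" for j
      using that
    proof (induction j)
      case 0
      then show ?case using eqI[of 0] by simp
    next
      case (Suc j)
      then show ?case using eqI[of "Suc j"] step[OF D(1), of j] step[OF D(2), of j] by (cases "Suc j \<in> I") auto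
    qed
    then have "D \<inter> C = D' \<inter> C" unfolding m(3) cycle_edges_def \<epsilon>_def by auto
    then show "D = D'" by (rule odd_set_eqI[OF C D(1,2)])
  qed
  moreover have finI: "finite ?I" unfolding I_def by simp
  ultimately have "card odd_sets \<le> card (Pow ?I)" by (intro card_inj_on_le) auto
  then have "5 \<le> (2::nat) ^ card ?I" using five card_Pow[OF finI] by simp
  moreover have "(2::nat) ^ card ?I \<le> 2 ^ 2" if "card ?I \<le> 2" using that by (intro power_increasing) auto
  ultimately have card3: "card ?I \<ge> 3" by (cases "card ?I \<le> 2") auto
  have "?I \<noteq> {0}"
  proof
    assume "?I = {0}"
    then have "card ?I = card {0::nat}" by (rule arg_cong)
    then show False using card3 by simp
  qed
  then obtain j where "j \<in> I" by blast
  then have "\<gamma> j \<in> \<Union>C \<inter> \<Union>(E - C)"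
    using Union_cycle_edges[of m \<gamma>] m unfolding I_def by auto
  then have "v \<in> \<Union>(E - C)" using v(2) by blast
  then have "0 \<in> I" using g(4) m(1) unfolding I_def by auto
  then show thesis using that[OF C m I_def] card3 by (simp add: insert_absorb)
qed

text \<open>The common vertices cut \<open>C\<close> into arcs. For each of them, the arc of the other odd cycle with
  the same ends and the same parity forms an even set with it, so it consists of the partners of
  its edges. These two arcs are the cycle of the ring.\<close>

lemma ring_of_even_degrees:
  assumes ev: "even_degrees E" and five: "card odd_sets \<ge> 5" and G: "edges G = E" "verts G = \<Union>E"
  shows "in_family_E G"
proof -
  obtain C \<gamma> m I where C: "C \<in> odd_sets" and m: "m \<ge> 3" "inj_on \<gamma> {..<m}" "C = cycle_edges \<gamma> m"
    and I: "I = {j \<in> {..<m}. \<gamma> j \<in> \<Union>(E - C)}" "0 \<in> I" "card I \<ge> 3"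
    by (rule three_common_vertices[OF ev five])
  let ?C' = "E - C"
  have C': "?C' \<in> odd_sets" using complement_odd_set[OF ev C] .
  have CE: "C \<subseteq> E" using C unfolding odd_sets_def by auto
  define k where "k = card I"
  have k3: "k \<ge> 3" using I(3) unfolding k_def .
  have "I \<subseteq> {..<m}" using I(1) by blast
  then obtain s where s: "strict_mono s" "s 0 = 0" "s k = m"
    and s_I: "\<forall>l<k. s l \<in> I" and s_gap: "\<forall>l<k. \<forall>j. s l < j \<longrightarrow> j < s (Suc l) \<longrightarrow> j \<notin> I"
    by (rule increasing_enumeration[OF _ I(2), folded k_def])
  have s_le: "s a \<le> s b \<longleftrightarrow> a \<le> b" "s a < s b \<longleftrightarrow> a < b" for a b
    using s(1) by (simp_all add: strict_mono_less_eq strict_mono_less)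
  define p where "p l = s (Suc l) - s l" for l
  have sp: "s l + p l = s (Suc l)" for l unfolding p_def using s_le(1)[of l "Suc l"] by simp
  have p_pos: "0 < p l" for l unfolding p_def using s_le(2)[of l "Suc l"] by simp
  have s_lt: "s l + j < m" if "l < k" "j < p l" for l j
  proof -
    have "s l + j < s (Suc l)" using that(2) sp[of l] by simp
    also have "\<dots> \<le> m" using s_le(1)[of "Suc l" k] s(3) that(1) by simp
    finally show ?thesis .
  qed
  define \<delta> where "\<delta> l j = \<gamma> ((s l + j) mod m)" for l j
  have d_lt: "\<delta> l j = \<gamma> (s l + j)" if "l < k" "j < p l" for l j
    unfolding \<delta>_def using s_lt[OF that] by simp
  have d_end: "\<delta> l (p l) = \<delta> (Suc l mod k) 0" if "l < k" for l
  proof (cases "Suc l = k")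
    case True
    then show ?thesis unfolding \<delta>_def sp using s(2,3) by simp
  next
    case False
    then show ?thesis unfolding \<delta>_def sp using that by simp
  qed
  have p_lt: "p l < m" if "l < k" for l
  proof (rule ccontr)
    assume "\<not> p l < m"
    then have "s (Suc l) \<ge> s l + m" using sp[of l] by linarith
    moreover have "s (Suc l) \<le> m" using s_le(1)[of "Suc l" k] s(3) that by simp
    ultimately have "s l = 0" "s (Suc l) = s k" using s(3) by linarith+
    then have "l = 0" "Suc l = k" using s(1,2) by (metis strict_mono_eq)+
    then show False using k3 by simp
  qed
  have d_inj: "inj_on (\<delta> l) {..p l}" if "l < k" for l
  proof -
    have "inj_on (\<lambda>j. \<gamma> ((j + s l) mod m)) {..<m}" using cycle_edges_rotate(1)[OF m(2)] m(1) by simp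
    then show ?thesis unfolding \<delta>_def using p_lt[OF that] by (simp add: add.commute inj_on_def)
  qed
  let ?P = "\<lambda>l. path_edges (\<delta> l) (p l)"
  have P_eq: "?P l = (\<lambda>j. {\<gamma> j, \<gamma> (Suc j mod m)}) ` {s l..<s (Suc l)}" if "l < k" for l
  proof -
    have "{s l..<s (Suc l)} = (\<lambda>j. s l + j) ` {..<p l}"
      unfolding sp[symmetric] by (simp add: lessThan_atLeast0 image_add_atLeastLessThan add.commute)
    moreover have "{\<delta> l j, \<delta> l (Suc j)} = {\<gamma> (s l + j), \<gamma> (Suc (s l + j) mod m)}" if "j < p l" for j
      using d_lt[OF \<open>l < k\<close> that] unfolding \<delta>_def by simp
    ultimately show ?thesis unfolding path_edges_def by (simp add: image_image)
  qed
  have P_cover: "\<exists>l<k. e \<in> ?P l" if e: "e \<in> C" for e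
  proof -
    obtain j where j: "j < m" "e = {\<gamma> j, \<gamma> (Suc j mod m)}" using e m(3) unfolding cycle_edges_def by auto
    then obtain l where "l < k" "s l \<le> j" "j < s (Suc l)" using enumeration_cover[of s j k] s(2,3) by auto
    then show ?thesis using P_eq j(2) by auto
  qed
  have P_sub: "?P l \<subseteq> C" if "l < k" for l
    unfolding P_eq[OF that] m(3) cycle_edges_def using s_le(1)[of "Suc l" k] s(3) that by auto
  have P_disj: "l = l'" if l: "l < k" "l' < k" "e \<in> ?P l" "e \<in> ?P l'" for l l' e
  proof -
    obtain j j' where j: "s l \<le> j" "j < s (Suc l)" "s l' \<le> j'" "j' < s (Suc l')"
      "e = {\<gamma> j, \<gamma> (Suc j mod m)}" "e = {\<gamma> j', \<gamma> (Suc j' mod m)}"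
      using l(3,4) unfolding P_eq[OF l(1)] P_eq[OF l(2)] by auto
    have "j < m" "j' < m" using j s_le(1)[of "Suc l" k] s_le(1)[of "Suc l'" k] s(3) l(1,2) by auto
    then have "j = j'" using cycle_edge_inj[OF m(1,2)] j(5,6) by blast
    then show ?thesis using enumeration_unique[OF s(1)] j by blast
  qed
  have UC: "\<Union>C = \<gamma> ` {..<m}" using Union_cycle_edges[of m \<gamma>] m by simp
  have dC: "\<delta> l j \<in> \<Union>C" for l j
    unfolding UC \<delta>_def using m(1) by auto
  have start_common: "\<delta> l 0 \<in> \<Union>?C'" if "l < k" for l
    using s_I[rule_format, OF that] d_lt[OF that p_pos] I(1) by auto
  have interior_P: "\<delta> l j \<notin> \<Union>?C'" if "l < k" "0 < j" "j < p l" for l j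
  proof -
    have "s l < s l + j" "s l + j < s (Suc l)" using that sp[of l] by auto
    then have "s l + j \<notin> I" using s_gap that(1) by blast
    then show ?thesis using d_lt[OF that(1,3)] s_lt[OF that(1,3)] I(1) by auto
  qed
  have Suc_lt: "Suc l mod k < k" for l using k3 by simp
  have "\<exists>\<rho> q. l < k \<longrightarrow> inj_on \<rho> {..q} \<and> \<rho> 0 = \<delta> l 0 \<and> \<rho> q = \<delta> l (p l) \<and> 0 < q \<and> path_edges \<rho> q \<subseteq> ?C' \<and>
      ?P l \<union> path_edges \<rho> q \<in> even_sets" for l
  proof (cases "l < k")
    case True
    have ne: "\<delta> l 0 \<noteq> \<delta> l (p l)" using inj_onD[OF d_inj[OF True], of 0 "p l"] p_pos[of l] by auto
    have deg_P: "odd (deg (?P l) v) \<longleftrightarrow> v = \<delta> l 0 \<or> v = \<delta> l (p l)" for v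
      using deg_path_edges[OF d_inj[OF True]] p_pos by simp
    have sub: "?P l \<subseteq> E - ?C'" using P_sub[OF True] CE by auto
    have common: "\<delta> l 0 \<in> \<Union>?C'" "\<delta> l (p l) \<in> \<Union>?C'"
      using start_common[OF True] start_common[OF Suc_lt, of l] d_end[OF True] by simp_all
    obtain \<rho> q where "inj_on \<rho> {..q}" "\<rho> 0 = \<delta> l 0" "\<rho> q = \<delta> l (p l)" "0 < q"
      "path_edges \<rho> q \<subseteq> ?C'" "?P l \<union> path_edges \<rho> q \<in> even_sets"
      by (rule arc_of_same_parity[OF C' common ne sub deg_P])
    then show ?thesis by (intro exI[of _ \<rho>] exI[of _ q] impI conjI)
  qed simp
  then obtain \<rho> q where rq: "\<And>l. l < k \<Longrightarrow> inj_on (\<rho> l) {..q l} \<and> \<rho> l 0 = \<delta> l 0 \<and> \<rho> l (q l) = \<delta> l (p l) \<and>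
      0 < q l \<and> path_edges (\<rho> l) (q l) \<subseteq> ?C' \<and> ?P l \<union> path_edges (\<rho> l) (q l) \<in> even_sets"
    by metis
  let ?Q = "\<lambda>l. path_edges (\<rho> l) (q l)"
  have r: "inj_on (\<rho> l) {..q l}" "\<rho> l 0 = \<delta> l 0" "\<rho> l (q l) = \<delta> l (p l)" "0 < q l" "?Q l \<subseteq> ?C'"
    "?P l \<union> ?Q l \<in> even_sets" if "l < k" for l
    using rq[OF that] by simp_all
  have Q_partner: "f \<in> ?Q l \<longleftrightarrow> e \<in> ?P l" if "l < k" "partner e f" "f \<in> ?C'" for l e f
  proof -
    have "e \<in> C" using odd_set_partner[OF C that(2)] that(3) by blast
    then have "e \<notin> ?Q l" "f \<notin> ?P l" using r(5)[OF that(1)] P_sub[OF that(1)] that(3) by auto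
    then show ?thesis using even_set_partner[OF r(6)[OF that(1)] that(2)] by blast
  qed
  have partner_C: "\<exists>e\<in>C. partner e f" if "f \<in> ?C'" for f
  proof -
    obtain e where e: "partner f e" using partnerE \<open>f \<in> ?C'\<close> by blast
    then show ?thesis using odd_set_partner[OF C e] \<open>f \<in> ?C'\<close> partner_sym[OF e] by blast
  qed
  have Q_cover: "\<exists>l<k. f \<in> ?Q l" if "f \<in> ?C'" for f
    using partner_C[OF that] P_cover Q_partner[OF _ _ that] by blast
  have Q_disj: "l = l'" if l: "l < k" "l' < k" "f \<in> ?Q l" "f \<in> ?Q l'" for l l' f
  proof -
    have f: "f \<in> ?C'" using r(5)[OF l(1)] l(3) by blast
    obtain e where e: "partner e f" using partner_C[OF f] by blast
    show ?thesis using P_disj[OF l(1,2)] Q_partner[OF l(1) e f] Q_partner[OF l(2) e f] l(3,4) by blast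
  qed
  have two_at: "deg (?Q l) (\<rho> l j) = 2" if "l < k" "0 < j" "j < q l" for l j
    using path_edges_at_interior[OF r(1)[OF that(1)] that(2,3)] by simp
  have one_at: "\<exists>g\<in>?Q l. \<rho> l j \<in> g" if "j < q l" for l j
    using that unfolding path_edges_def by auto
  \<comment> \<open>Exchanging the two arcs in \<open>C\<close> gives an odd cycle, in which a common vertex inside the new arc
    would have too many edges.\<close>
  have interior_Q: "\<rho> l j \<notin> \<Union>C" if l: "l < k" and j: "0 < j" "j < q l" for l j
  proof
    assume w: "\<rho> l j \<in> \<Union>C"
    let ?w = "\<rho> l j"
    have wC': "?w \<in> \<Union>?C'" using one_at[OF j(2)] r(5)[OF l] by blast
    have "?w \<noteq> \<delta> l 0" "?w \<noteq> \<delta> l (p l)"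
      using inj_onD[OF r(1)[OF l], of j 0] inj_onD[OF r(1)[OF l], of j "q l"] r(2,3)[OF l] j by auto
    then have off: "?w \<noteq> \<delta> l i" if "i \<le> p l" for i
      using interior_P[OF l, of i] wC' that by (cases "i = 0"; cases "i = p l") auto
    then have noP: "?w \<notin> \<Union>(?P l)" using Union_path_edges[of "\<delta> l" "p l"] by blast
    let ?D = "sym_diff C (?P l \<union> ?Q l)"
    have D: "?D \<in> odd_sets" using odd_even_sym_diff[OF C r(6)[OF l]] .
    obtain g where g: "g \<in> ?Q l" "?w \<in> g" using one_at[OF j(2)] by blast
    have "insert g {e \<in> C. ?w \<in> e} \<subseteq> {e \<in> ?D. ?w \<in> e}"
      using g noP r(5)[OF l] by blast
    then have "card (insert g {e \<in> C. ?w \<in> e}) \<le> deg ?D ?w"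
      using D finite_E unfolding odd_sets_def by (intro card_mono) (auto intro: finite_subset)
    moreover have "g \<notin> C" using g(1) r(5)[OF l] by blast
    moreover have "deg C ?w = 2" using cycle_deg[OF odd_set_is_cycle[OF C]] w by simp
    moreover have "finite {e \<in> C. ?w \<in> e}" using CE subset_finite by simp
    ultimately have "3 \<le> deg ?D ?w" by simp
    then show False using cycle_deg[OF odd_set_is_cycle[OF D], of ?w] by (simp split: if_splits)
  qed
  have interiors_Q: "l = l'" if l: "l < k" "l' < k" and j: "0 < j" "j < q l" "0 < j'" "j' < q l'"
    and eq: "\<rho> l j = \<rho> l' j'" for l l' j j'
  proof (rule ccontr)
    assume "l \<noteq> l'"
    obtain g where g: "g \<in> ?Q l'" "\<rho> l j \<in> g" using one_at[OF j(4)] eq by metis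
    have "g \<notin> ?Q l" using Q_disj[OF l] g(1) \<open>l \<noteq> l'\<close> by blast
    then have "card (insert g {e \<in> ?Q l. \<rho> l j \<in> e}) = 3" using two_at[OF l(1) j(1,2)] by simp
    moreover have "insert g {e \<in> ?Q l. \<rho> l j \<in> e} \<subseteq> {e \<in> ?C'. \<rho> l j \<in> e}"
      using g r(5)[OF l(1)] r(5)[OF l(2)] by blast
    then have "card (insert g {e \<in> ?Q l. \<rho> l j \<in> e}) \<le> deg ?C' (\<rho> l j)"
      using finite_E by (intro card_mono) auto
    ultimately show False
      using cycle_deg[OF odd_set_is_cycle[OF C'], of "\<rho> l j"] by (simp split: if_splits)
  qed
  define n where "n l = (p l + q l) div 2" for l
  have n2: "2 * n l = p l + q l" and n_ge: "n l \<ge> 2" if l: "l < k" for l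
  proof -
    have disj: "?P l \<inter> ?Q l = {}" using P_sub[OF l] r(5)[OF l] by blast
    then have "card (?P l \<union> ?Q l) = p l + q l"
      using card_Un_disjoint[of "?P l" "?Q l"] card_path_edges[OF d_inj[OF l]] card_path_edges[OF r(1)[OF l]] by simp
    then have even: "even (p l + q l)" using r(6)[OF l] unfolding even_sets_def by simp
    then show n2: "2 * n l = p l + q l" unfolding n_def by simp
    have "\<not> (p l = 1 \<and> q l = 1)"
    proof
      assume one: "p l = 1 \<and> q l = 1"
      then have "?P l = {{\<delta> l 0, \<delta> l (p l)}}" "?Q l = {{\<rho> l 0, \<rho> l (q l)}}" by (auto simp: path_edges_def)
      then show False using disj r(2,3)[OF l] by simp
    qed
    then show "n l \<ge> 2" using n2 p_pos[of l] r(4)[OF l] by linarith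
  qed
  define \<phi> where "\<phi> l = (\<lambda>j. if j \<le> p l then \<delta> l j else \<rho> l (p l + q l - j))" for l
  have phi_cycle: "cycle_edges (\<phi> l) (2 * n l) = ?P l \<union> ?Q l" if "l < k" for l
    unfolding \<phi>_def n2[OF that]
    using cycle_edges_two_paths[of "\<delta> l" "\<rho> l" "p l" "q l"] r(2-4)[OF that] p_pos by simp
  have E_eq: "E = (\<Union>l<k. cycle_edges (\<phi> l) (2 * n l))"
  proof -
    have "(\<Union>l<k. cycle_edges (\<phi> l) (2 * n l)) = (\<Union>l<k. ?P l \<union> ?Q l)"
      using phi_cycle by (intro SUP_cong) auto
    moreover have "\<dots> = E"
    proof
      show "(\<Union>l<k. ?P l \<union> ?Q l) \<subseteq> E" using P_sub r(5) CE by blast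
      show "E \<subseteq> (\<Union>l<k. ?P l \<union> ?Q l)"
      proof
        fix e assume "e \<in> E"
        then consider "e \<in> C" | "e \<in> ?C'" by blast
        then show "e \<in> (\<Union>l<k. ?P l \<union> ?Q l)" using P_cover Q_cover by cases blast+
      qed
    qed
    ultimately show ?thesis by simp
  qed
  have V_eq: "\<Union>E = (\<Union>l<k. \<phi> l ` {..<2 * n l})"
  proof -
    have "\<Union>(cycle_edges (\<phi> l) (2 * n l)) = \<phi> l ` {..<2 * n l}" if "l < k" for l
      using n_ge[OF that] by (intro Union_cycle_edges) simp
    then have "(\<Union>l<k. \<Union>(cycle_edges (\<phi> l) (2 * n l))) = (\<Union>l<k. \<phi> l ` {..<2 * n l})"
      by (intro SUP_cong) auto
    moreover have "\<Union>E = \<Union>(\<Union>l<k. cycle_edges (\<phi> l) (2 * n l))" using E_eq by (rule arg_cong)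
    moreover have "\<dots> = (\<Union>l<k. \<Union>(cycle_edges (\<phi> l) (2 * n l)))" by blast
    ultimately show ?thesis by (simp only:)
  qed
  have phi_end: "\<phi> l (p l) = \<phi> (Suc l mod k) 0" if "l < k" for l
    using d_end[OF that] unfolding \<phi>_def by simp
  \<comment> \<open>On \<open>C\<close>, a value of \<open>\<phi>\<close> determines the position, up to the choice between the end of an arc and
    the start of the next one.\<close>
  have on_C: "(l, j) = (l', j')" if l: "l < k" "l' < k" "j < p l" "j' < p l'" "\<delta> l j = \<delta> l' j'" for l l' j j'
  proof -
    have "s l + j = s l' + j'"
      using l(5) d_lt[OF l(1,3)] d_lt[OF l(2,4)] s_lt[OF l(1,3)] s_lt[OF l(2,4)] m(2) by (auto dest: inj_onD)
    moreover have "l = l'"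
      using enumeration_unique[OF s(1), of l "s l + j" l'] sp[of l] sp[of l'] l(3,4) calculation by simp
    ultimately show ?thesis by simp
  qed
  have kernel: "(l, j) = (l', j') \<or> ((l, j), (l', j')) \<in> glued k (\<lambda>_. 0) p \<or> ((l', j'), (l, j)) \<in> glued k (\<lambda>_. 0) p"
    if l: "l < k" "j < 2 * n l" "l' < k" "j' < 2 * n l'" "\<phi> l j = \<phi> l' j'" for l j l' j'
  proof -
    have glued_iff: "((l, j), (l', j')) \<in> glued k (\<lambda>_. 0) p \<longleftrightarrow> l < k \<and> j = p l \<and> l' = Suc l mod k \<and> j' = 0"
      for l j l' j' unfolding glued_def by auto
    have small: "\<phi> l j \<in> \<Union>C" if "j \<le> p l" for l j using dC that unfolding \<phi>_def by auto
    have big: "\<phi> l j \<notin> \<Union>C" "\<phi> l j = \<rho> l (p l + q l - j)" "0 < p l + q l - j" "p l + q l - j < q l"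
      if "l < k" "j < 2 * n l" "\<not> j \<le> p l" for l j
      using interior_Q[OF that(1), of "p l + q l - j"] that n2[OF that(1)] unfolding \<phi>_def by auto
    show ?thesis
    proof (cases "j \<le> p l")
      case True
      then have j': "j' \<le> p l'" using small[OF True] big(1)[OF l(3,4)] l(5) by auto
      have eq: "\<delta> l j = \<delta> l' j'" using l(5) True j' unfolding \<phi>_def by simp
      consider "j < p l" "j' < p l'" | "j = p l" "j' < p l'" | "j < p l" "j' = p l'" | "j = p l" "j' = p l'"
        using True j' by linarith
      then show ?thesis
      proof cases
        case 1
        then show ?thesis using on_C[OF l(1,3) _ _ eq] by blast
      next
        case 2
        then have "\<delta> (Suc l mod k) 0 = \<delta> l' j'" using eq d_end[OF l(1)] by simp
        then have "(Suc l mod k, 0) = (l', j')" using on_C[OF Suc_lt l(3) p_pos 2(2)] by blast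
        then have "((l, j), (l', j')) \<in> glued k (\<lambda>_. 0) p" using 2(1) l(1) unfolding glued_iff by simp
        then show ?thesis by blast
      next
        case 3
        then have "\<delta> l j = \<delta> (Suc l' mod k) 0" using eq d_end[OF l(3)] by simp
        then have "(l, j) = (Suc l' mod k, 0)" using on_C[OF l(1) Suc_lt 3(1) p_pos] by blast
        then have "((l', j'), (l, j)) \<in> glued k (\<lambda>_. 0) p" using 3(2) l(3) unfolding glued_iff by simp
        then show ?thesis by blast
      next
        case 4
        then have "\<delta> (Suc l mod k) 0 = \<delta> (Suc l' mod k) 0" using eq d_end[OF l(1)] d_end[OF l(3)] by simp
        then have "Suc l mod k = Suc l' mod k" using on_C[OF Suc_lt Suc_lt p_pos p_pos] by blast
        then show ?thesis using Suc_mod_inj[OF l(1,3)] 4 by simp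
      qed
    next
      case False
      then have j': "\<not> j' \<le> p l'" using small[of j' l'] big(1)[OF l(1,2)] l(5) by auto
      note b = big(2-4)[OF l(1,2) False] and b' = big(2-4)[OF l(3,4) j']
      have ll: "l = l'" using interiors_Q[OF l(1,3) b(2,3) b'(2,3)] b(1) b'(1) l(5) by simp
      then have "p l + q l - j = p l + q l - j'"
        using b b' l(5) inj_onD[OF r(1)[OF l(1)], of "p l + q l - j" "p l + q l - j'"] by simp
      then have "j = j'" using b(2) by linarith
      then show ?thesis using ll by simp
    qed
  qed
  have "ring_map G k n (\<lambda>_. 0) p \<phi>"
    unfolding ring_map_def G by (intro conjI allI impI V_eq E_eq phi_end kernel)
  moreover have "odd (\<Sum>l<k. 0 + p l)"
  proof -
    have "(\<Sum>l<k. 0 + p l) = m" unfolding p_def using sum_differences[OF s(1), of k] s(2,3) by simp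
    moreover have "odd m" using C card_cycle_edges[OF m(1,2)] m(3) unfolding odd_sets_def by simp
    ultimately show ?thesis by simp
  qed
  moreover have "\<forall>l<k. n l \<ge> 2 \<and> 0 < 2 * n l \<and> p l < 2 * n l \<and> 0 \<noteq> p l"
  proof (intro allI impI conjI)
    fix l assume l: "l < k"
    show "n l \<ge> 2" "0 < 2 * n l" "p l < 2 * n l" "0 \<noteq> p l"
      using n_ge[OF l] n2[OF l] p_pos[of l] r(4)[OF l] by simp_all
  qed
  ultimately show ?thesis
    unfolding in_family_E_iff using k3
    by (intro exI[of _ k] exI[of _ n] exI[of _ "\<lambda>_. 0"] exI[of _ p] exI[of _ \<phi>] conjI)
qed

end

section \<open>Critical graphs with at least five odd cycles\<close>

theorem theorem1p3:
  fixes G :: "'a graph"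
  assumes "simple_graph G"
  shows "(no_isolated G \<and> critical_3_2 G \<and> card (odd_cycles G) \<ge> 5) \<longleftrightarrow> in_family_E G"
proof
  assume L: "no_isolated G \<and> critical_3_2 G \<and> card (odd_cycles G) \<ge> 5"
  then interpret critical_edges "edges G"
    using critical_iff[OF assms] finite_edges[OF assms] assms
    by unfold_locales (auto simp: simple_graph_def)
  have five: "card odd_sets \<ge> 5"
    using L unfolding odd_sets_eq_odd_cycles card_odd_cycles[OF assms] by simp
  then have "even_degrees (edges G)"
    using card_odd_sets_odd_degree unfolding even_degrees_def by fastforce
  moreover have "verts G = \<Union>(edges G)"
    using L assms unfolding no_isolated_def simple_graph_def by blast
  ultimately show "in_family_E G" using ring_of_even_degrees five by blast
next
  assume "in_family_E G"
  then obtain k n x y \<phi> where "k \<ge> 3" "\<forall>i<k. n i \<ge> 2 \<and> x i < 2 * n i \<and> y i < 2 * n i \<and> x i \<noteq> y i"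
    "odd (\<Sum>i<k. x i + y i)" "ring_map G k n x y \<phi>"
    unfolding in_family_E_iff by blast
  then interpret ring G k n x y \<phi> using assms by unfold_locales auto
  show "no_isolated G \<and> critical_3_2 G \<and> card (odd_cycles G) \<ge> 5"
    using no_isolated critical five_odd_cycles by blast
qed

end
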